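(* Let $(X,\|\cdot\|_X)$, $(Y,\|\cdot\|_Y)$ be Banach spaces, $F:X\times Y\to X$, $G:X\times Y\to Y$, and let $x_n\in X$, $y_n\in Y$ be sequences satisfying $$x_{n+1}=x_n+\alpha_{n+1}\big[F(x_n,y_n)+U_{n+1}+c_{n+1}\big],\qquad y_{n+1}=y_n+\gamma_{n+1}\big[G(x_n,y_n)+V_{n+1}+d_{n+1}\big],$$ where $\{\alpha_n\},\{\gamma_n\}$ are the (positive) learning rate sequences, $\{U_n\}$ and $\{V_n\}$ are stochastic processes in $X$ and $Y$ respectively, and $c_n\in X$, $d_n\in Y$ are bias terms that converge almost surely to $0$. Suppose that Assumptions A1--A4 listed in the context hold. Then the interpolation $\bar x^\alpha:\mathbb{R}_+\to X$ defined by $$\bar x^\alpha(\tau^\alpha_n+s)=x_n+s\,\frac{x_{n+1}-x_n}{\alpha_{n+1}},\qquad s\in[0,\alpha_{n+1}),$$ where $\tau^\alpha_n=\sum_{j=1}^n\alpha_j$ and $\tau^\alpha_0=0$, is an asymptotic pseudo-trajectory to the flow induced by the differential equation $$\frac{dx}{dt}=F(x,y^*(x)).$$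
   Context: Let $\tau^\alpha_n=\sum_{j=1}^n\alpha_j$, $\tau^\alpha_0=0$, $m^\alpha(t)=\sup\{k\ge0:\tau^\alpha_k\le t\}$, and similarly $\tau^\gamma_n=\sum_{j=1}^n\gamma_j$, $\tau^\gamma_0=0$, $m^\gamma(t)=\sup\{k\ge0:\tau^\gamma_k\le t\}$. Assumptions: A1 (noise control). (a) For all $T>0$, $\lim_{n\to\infty}\sup_{k\in\{n+1,\ldots,m^\alpha(\tau^\alpha_n+T)\}}\big\|\sum_{j=n}^{k-1}\alpha_{j+1}U_{j+1}\big\|_X=0$ and $\lim_{n\to\infty}\sup_{k\in\{n+1,\ldots,m^\gamma(\tau^\gamma_n+T)\}}\big\|\sum_{j=n}^{k-1}\gamma_{j+1}V_{j+1}\big\|_Y=0$. (b) $\{c_n\}$ and $\{d_n\}$ are bounded sequences with $\|c_n\|_X\to0$ and $\|d_n\|_Y\to0$ as $n\to\infty$. A2 (boundedness and continuity). (a) There exist compact sets $C\subset X$ and $D\subset Y$ such that $x_n\in C$ and $y_n\in D$ for all $n\in\mathbb{N}$. (b) $F$ and $G$ are bounded and uniformly continuous on $C\times D$. A3 (learning rates). (a) $\sum_{n=1}^\infty\alpha_n=\infty$ and $\sum_{n=1}^\infty\gamma_n=\infty$, with $\alpha_n\to0$ and $\gamma_n\to0$ as $n\to\infty$. (b) $\alpha_n/\gamma_n\to0$ as $n\to\infty$. A4 (mean field behaviour). (a) For any fixed $\tilde x\in C$ the differential equation $dy/dt=G(\tilde x,y)$ has unique solution trajectories that remain in $D$ for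 any initial value $y_0\in D$. Furthermore, this differential equation has a unique globally attracting fixed point $y^*(\tilde x)$, and the function $y^*:C\to D$ is Lipschitz continuous. (b) The differential equation $dx/dt=F(x,y^*(x))$ has unique solution trajectories that remain in $C$ for any initial value $x_0\in C$. A semiflow $\Phi$ on a metric space $(M,d)$ is a continuous map $\Phi:\mathbb{R}_+\times M\to M$, $(t,x)\mapsto\Phi_t(x)$, such that $\Phi_0(x)=x$ and $\Phi_{t+s}(x)=\Phi_t(\Phi_s(x))$ for all $t,s\ge0$. A continuous function $z:\mathbb{R}_+\to M$ is an asymptotic pseudo-trajectory for $\Phi$ if for any $T>0$, $\lim_{t\to\infty}\sup_{0\le s\le T}d\big(z(t+s),\Phi_s(z(t))\big)=0$.
   Formalization: In A4(a), "globally attracting fixed point" is taken to include Lyapunov stability as well as convergence of every trajectory (without it the claim fails); where the interpolation leaves C, the claim is made for semiflows extending the flow and for nearby starting points in C. *)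

theory Defs
  imports "HOL-Probability.Probability"
begin

definition tau :: "(nat \<Rightarrow> real) \<Rightarrow> nat \<Rightarrow> real" where
  "tau a n = (\<Sum>j=1..n. a j)"

text \<open>The set below is finite, so that the supremum is its maximum, as soon as
  \<open>tau a\<close> tends to infinity and \<open>a\<close> is positive.\<close>
definition clock :: "(nat \<Rightarrow> real) \<Rightarrow> real \<Rightarrow> nat" where
  "clock a t = Sup {k. tau a k \<le> t}"

text \<open>The index set of the supremum is finite; it is nonempty for all large \<open>n\<close> when \<open>a\<close>
  tends to \<open>0\<close>, so the unspecified value of the supremum over the empty set is irrelevant for
  the limit.\<close>
definition noise_vanishes :: "(nat \<Rightarrow> real) \<Rightarrow> (nat \<Rightarrow> 'a::real_normed_vector) \<Rightarrow> bool" where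
  "noise_vanishes a u \<longleftrightarrow>
     (\<forall>T>0. (\<lambda>n. SUP k\<in>{n + 1..clock a (tau a n + T)}.
                    norm (\<Sum>j=n..<k. a (j + 1) *\<^sub>R u (j + 1))) \<longlonglongrightarrow> 0)"

definition ode_solution ::
    "'a::real_normed_vector set \<Rightarrow> ('a \<Rightarrow> 'a) \<Rightarrow> 'a \<Rightarrow> (real \<Rightarrow> 'a) \<Rightarrow> bool" where
  "ode_solution S f u0 \<phi> \<longleftrightarrow> \<phi> 0 = u0 \<and>
     (\<forall>t\<ge>0. \<phi> t \<in> S \<and> (\<phi> has_vector_derivative f (\<phi> t)) (at t within {0..}))"

text \<open>Uniqueness is only required among solutions that stay in \<open>S\<close>; the right-hand side need
  not be meaningful elsewhere.\<close>
definition unique_solutions_in :: "'a::real_normed_vector set \<Rightarrow> ('a \<Rightarrow> 'a) \<Rightarrow> bool" where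
  "unique_solutions_in S f \<longleftrightarrow>
     (\<forall>u0\<in>S. \<exists>\<phi>. ode_solution S f u0 \<phi> \<and>
        (\<forall>\<psi>. ode_solution S f u0 \<psi> \<longrightarrow> (\<forall>t\<ge>0. \<psi> t = \<phi> t)))"

text \<open>Meaningful for \<open>u0 \<in> S\<close> and \<open>t \<ge> 0\<close> under \<open>unique_solutions_in S f\<close>.\<close>
definition ode_flow :: "'a::real_normed_vector set \<Rightarrow> ('a \<Rightarrow> 'a) \<Rightarrow> real \<Rightarrow> 'a \<Rightarrow> 'a" where
  "ode_flow S f t u0 = (SOME \<phi>. ode_solution S f u0 \<phi>) t"

text \<open>Attraction is meant in the sense of an attractor whose basin is all of \<open>S\<close>, that is,
  Lyapunov stability together with convergence of every trajectory. Convergence alone would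
  admit a fixed point with a homoclinic orbit (such as \<open>0\<close> for \<open>\<theta>' = 1 - cos \<theta>\<close> on the circle), and
  vanishing perturbations can then drive an iteration along that orbit infinitely often. For continuous semiflows on
  compact \<open>S\<close>, this is the same as convergence uniformly in the initial value.\<close>
definition globally_attracting_fixed_point ::
    "'a::real_normed_vector set \<Rightarrow> ('a \<Rightarrow> 'a) \<Rightarrow> 'a \<Rightarrow> bool" where
  "globally_attracting_fixed_point S f p \<longleftrightarrow> p \<in> S \<and> f p = 0 \<and>
     (\<forall>u0\<in>S. \<forall>\<phi>. ode_solution S f u0 \<phi> \<longrightarrow> (\<phi> \<longlongrightarrow> p) at_top) \<and>
     (\<forall>\<epsilon>>0. \<exists>\<delta>>0. \<forall>u0\<in>S. \<forall>\<phi>. dist u0 p < \<delta> \<and> ode_solution S f u0 \<phi> \<longrightarrow>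
        (\<forall>t\<ge>0. dist (\<phi> t) p < \<epsilon>))"

definition semiflow_on :: "'a::metric_space set \<Rightarrow> (real \<Rightarrow> 'a \<Rightarrow> 'a) \<Rightarrow> bool" where
  "semiflow_on M \<Phi> \<longleftrightarrow>
     (\<forall>t\<ge>0. \<forall>x\<in>M. \<Phi> t x \<in> M) \<and>
     continuous_on ({0..} \<times> M) (\<lambda>(t, x). \<Phi> t x) \<and>
     (\<forall>x\<in>M. \<Phi> 0 x = x) \<and>
     (\<forall>t\<ge>0. \<forall>s\<ge>0. \<forall>x\<in>M. \<Phi> (t + s) x = \<Phi> t (\<Phi> s x))"

definition asymptotic_pseudotrajectory ::
    "'a::metric_space set \<Rightarrow> (real \<Rightarrow> 'a \<Rightarrow> 'a) \<Rightarrow> (real \<Rightarrow> 'a) \<Rightarrow> bool" where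
  "asymptotic_pseudotrajectory M \<Phi> z \<longleftrightarrow>
     continuous_on {0..} z \<and> (\<forall>t\<ge>0. z t \<in> M) \<and>
     (\<forall>T>0. ((\<lambda>t. SUP s\<in>{0..T}. dist (z (t + s)) (\<Phi> s (z t))) \<longlongrightarrow> 0) at_top)"

text \<open>The iterates lie in \<open>C\<close>, but if \<open>C\<close> is not convex, then their interpolation \<open>z\<close> may leave
  \<open>C\<close>, where the flow \<open>\<Phi>\<close> on \<open>C\<close> is undefined. The claim that \<open>z\<close> is an asymptotic
  pseudo-trajectory is therefore made on every state space \<open>S\<close> that contains \<open>C\<close> and \<open>z\<close> and
  carries a semiflow extending \<open>\<Phi>\<close>. The case \<open>S = C\<close>, which always applies when \<open>C\<close> is convex,
  is the assertion for \<open>\<Phi>\<close> itself.\<close>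
definition asymptotic_pseudotrajectory_to_flow ::
    "'a::metric_space set \<Rightarrow> (real \<Rightarrow> 'a \<Rightarrow> 'a) \<Rightarrow> (real \<Rightarrow> 'a) \<Rightarrow> bool" where
  "asymptotic_pseudotrajectory_to_flow C \<Phi> z \<longleftrightarrow>
     (\<forall>S \<Psi>. C \<subseteq> S \<and> (\<forall>t\<ge>0. z t \<in> S) \<and> semiflow_on S \<Psi> \<and>
             (\<forall>t\<ge>0. \<forall>x\<in>C. \<Psi> t x = \<Phi> t x) \<longrightarrow>
        asymptotic_pseudotrajectory S \<Psi> z)"

lemma asymptotic_pseudotrajectory_to_flowD:
  assumes "asymptotic_pseudotrajectory_to_flow C \<Phi> z" "semiflow_on C \<Phi>"
    and "\<And>t. t \<ge> 0 \<Longrightarrow> z t \<in> C"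
  shows "asymptotic_pseudotrajectory C \<Phi> z"
  using assms unfolding asymptotic_pseudotrajectory_to_flow_def by blast

text \<open>Companion to the previous notion that does not need \<open>z\<close> to stay in the domain of the
  flow: the trajectory compared with \<open>z\<close> on \<open>[t, t + T]\<close> is started at a point \<open>p t\<close> of \<open>C\<close>
  that is asymptotically equal to \<open>z t\<close>. For \<open>z\<close> in \<open>C\<close>, take \<open>p = z\<close>.\<close>
definition asymptotically_shadows ::
    "'a::metric_space set \<Rightarrow> (real \<Rightarrow> 'a \<Rightarrow> 'a) \<Rightarrow> (real \<Rightarrow> 'a) \<Rightarrow> bool" where
  "asymptotically_shadows C \<Phi> z \<longleftrightarrow>
     continuous_on {0..} z \<and>
     (\<exists>p. (\<forall>t\<ge>0. p t \<in> C) \<and> ((\<lambda>t. dist (p t) (z t)) \<longlongrightarrow> 0) at_top) \<and>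
     (\<forall>p. (\<forall>t\<ge>0. p t \<in> C) \<and> ((\<lambda>t. dist (p t) (z t)) \<longlongrightarrow> 0) at_top \<longrightarrow>
        (\<forall>T>0. ((\<lambda>t. SUP s\<in>{0..T}. dist (z (t + s)) (\<Phi> s (p t))) \<longlongrightarrow> 0) at_top))"

lemma asymptotically_shadowsD:
  assumes "asymptotically_shadows C \<Phi> z" "\<And>t. t \<ge> 0 \<Longrightarrow> z t \<in> C"
  shows "asymptotic_pseudotrajectory C \<Phi> z"
proof -
  have "(\<forall>t\<ge>0. z t \<in> C) \<and> ((\<lambda>t. dist (z t) (z t)) \<longlongrightarrow> 0) at_top"
    using assms(2) by simp
  then show ?thesis
    using assms(1) unfolding asymptotically_shadows_def asymptotic_pseudotrajectory_def by blast
qed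

end

theory Submission
  imports Defs
begin

text \<open>
  The vector fields are merely continuous, so Gronwall estimates are unavailable. Instead, a
  compactness argument is used: approximate solutions with values in a compact set subconverge
  locally uniformly to solutions, which are unique. Hence the flow is jointly continuous, and an
  iteration with step sizes \<open>a n\<close> whose noise is negligible on bounded time windows follows the flow.

  On the time scale \<open>\<gamma>\<close>, the pair \<open>(x n, y n)\<close> is such an iteration for the vector field \<open>(0, G)\<close>,
  since \<open>\<alpha> n / \<gamma> n\<close> tends to \<open>0\<close>. Stability and attraction of \<open>ystar \<xi>\<close> then give
  \<open>y n - ystar (x n) \<longlonglongrightarrow> 0\<close>. Therefore \<open>x n\<close> on the time scale \<open>\<alpha>\<close> is such an iteration for
  \<open>\<lambda>u. F (u, ystar u)\<close>, with \<open>F (x n, y n) - F (x n, ystar (x n))\<close> as additional noise.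
\<close>

section \<open>Approximate solutions of differential equations\<close>

text \<open>The obstacle is that \<open>C\<close> and \<open>D\<close> need not be convex, so linear
  interpolations of the iterates can leave the sets on which \<open>F\<close> and \<open>G\<close>
  are controlled. Limits are therefore taken of the step functions \<open>u (clock a t)\<close>,
  which stay in the compact set. They jump, and this is why the error of an approximate solution has
  an additive part besides the linear one. The noise terms themselves need not be small; only their
  weighted sums over windows of bounded length are, so the estimates concern increments of the
  iterates. Compactness of the state space also replaces finite dimension, since the spaces are
  arbitrary Banach spaces. Interpolation enters only at the end: it differs from the step function
  by at most one increment of the iterates, and these increments tend to 0.\<close>

lemma diagonal_convergent_subsequence:
  fixes w :: "nat \<Rightarrow> 'i::countable \<Rightarrow> 'a::metric_space"
  assumes "compact S" "\<And>n q. w n q \<in> S"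
  obtains r where "strict_mono (r::nat \<Rightarrow> nat)" "\<And>q. convergent (\<lambda>n. w (r n) q)"
proof -
  have "compactin (product_topology (\<lambda>_. euclidean) UNIV) (Pi\<^sub>E (UNIV::'i set) (\<lambda>_. S))"
    using assms(1) by (subst compactin_PiE) auto
  \<comment> \<open>The index type is countable, so the function space is metrizable and Tychonoff
    compactness is sequential compactness; this replaces an explicit diagonal extraction.\<close>
  then have "seq_compact (Pi\<^sub>E (UNIV::'i set) (\<lambda>_. S))"
    by (metis compactin_euclidean_iff euclidean_product_topology compact_eq_seq_compact_metric)
  moreover have "\<forall>n. w n \<in> Pi\<^sub>E UNIV (\<lambda>_. S)"
    using assms(2) by auto
  ultimately obtain l r where r: "strict_mono (r::nat \<Rightarrow> nat)" "(w \<circ> r) \<longlonglongrightarrow> l"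
    unfolding seq_compact_def by blast
  have "(\<lambda>n. w (r n) q) \<longlonglongrightarrow> l q" for q
    using continuous_on_tendsto_compose[OF continuous_on_product_coordinates r(2)]
    by (simp add: o_def)
  then show ?thesis using r(1) that unfolding convergent_def by blast
qed

text \<open>The modulus \<open>\<eta>\<close> is uniform in \<open>n\<close>, while the error \<open>\<zeta>\<close> vanishes as \<open>n\<close> grows. Increments
  replace derivatives, because the approximate solutions of interest are step functions.\<close>
definition approximate_solutions ::
    "'a::real_normed_vector set \<Rightarrow> ('a \<Rightarrow> 'a) \<Rightarrow> (nat \<Rightarrow> real \<Rightarrow> 'a) \<Rightarrow> bool" where
  "approximate_solutions S f w \<longleftrightarrow>
     (\<forall>n. \<forall>t\<ge>0. w n t \<in> S) \<and>
     (\<forall>\<epsilon>>0. \<exists>\<eta>>0. \<forall>\<zeta>>0. \<forall>\<^sub>F n in sequentially. \<forall>s\<ge>0. \<forall>t\<ge>s. t - s \<le> \<eta> \<longrightarrow>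
        norm (w n t - w n s - (t - s) *\<^sub>R f (w n s)) \<le> \<epsilon> * (t - s) + \<zeta>)"

lemma approximate_solutions_in:
  "approximate_solutions S f w \<Longrightarrow> t \<ge> 0 \<Longrightarrow> w n t \<in> S"
  unfolding approximate_solutions_def by blast

lemma approximate_solutions_step:
  assumes "approximate_solutions S f w" "\<epsilon> > 0"
  obtains \<eta> where "\<eta> > 0" "\<And>\<zeta>. \<zeta> > 0 \<Longrightarrow> \<forall>\<^sub>F n in sequentially. \<forall>s\<ge>0. \<forall>t\<ge>s. t - s \<le> \<eta> \<longrightarrow>
        norm (w n t - w n s - (t - s) *\<^sub>R f (w n s)) \<le> \<epsilon> * (t - s) + \<zeta>"
  using assms unfolding approximate_solutions_def by blast

lemma approximate_solutions_reindex:
  assumes "approximate_solutions S f w" "filterlim r sequentially sequentially"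
  shows "approximate_solutions S f (\<lambda>n. w (r n))"
  unfolding approximate_solutions_def
proof (intro conjI allI impI)
  show "w (r n) t \<in> S" if "t \<ge> 0" for n t
    using approximate_solutions_in[OF assms(1) that] .
next
  fix \<epsilon> :: real assume "\<epsilon> > 0"
  obtain \<eta> where \<eta>: "\<eta> > 0" "\<And>\<zeta>. \<zeta> > 0 \<Longrightarrow> \<forall>\<^sub>F n in sequentially. \<forall>s\<ge>0. \<forall>t\<ge>s. t - s \<le> \<eta> \<longrightarrow>
        norm (w n t - w n s - (t - s) *\<^sub>R f (w n s)) \<le> \<epsilon> * (t - s) + \<zeta>"
    using approximate_solutions_step[OF assms(1) \<open>\<epsilon> > 0\<close>] by blast
  show "\<exists>\<eta>>0. \<forall>\<zeta>>0. \<forall>\<^sub>F n in sequentially. \<forall>s\<ge>0. \<forall>t\<ge>s. t - s \<le> \<eta> \<longrightarrow>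
        norm (w (r n) t - w (r n) s - (t - s) *\<^sub>R f (w (r n) s)) \<le> \<epsilon> * (t - s) + \<zeta>"
    using \<eta>(1) filterlim_iff[THEN iffD1, OF assms(2), rule_format, OF \<eta>(2)] by blast
qed

lemma continuous_on_compact_norm_bound:
  fixes f :: "'a::topological_space \<Rightarrow> 'b::real_normed_vector"
  assumes "compact S" "continuous_on S f"
  obtains M where "M > 0" "\<And>u. u \<in> S \<Longrightarrow> norm (f u) \<le> M"
  using compact_imp_bounded[OF compact_continuous_image[OF assms(2,1)]] that
  unfolding bounded_pos by blast

text \<open>A short increment is a drift of at most \<open>M\<close> times its length plus the
  error. Members of \<open>w\<close> may jump, so equicontinuity can only be expected at a fixed
  scale \<open>\<epsilon>\<close> and for large \<open>n\<close>.\<close>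

lemma approximate_solutions_equicontinuous:
  assumes w: "approximate_solutions S f w" and S: "compact S" "continuous_on S f" and "\<epsilon> > 0"
  obtains \<eta> where "\<eta> > 0" "\<forall>\<^sub>F n in sequentially. \<forall>s\<ge>0. \<forall>t\<ge>0. \<bar>t - s\<bar> \<le> \<eta> \<longrightarrow>
        dist (w n t) (w n s) \<le> \<epsilon>"
proof -
  obtain M where M: "M > 0" "\<And>u. u \<in> S \<Longrightarrow> norm (f u) \<le> M"
    using continuous_on_compact_norm_bound[OF S] by blast
  obtain \<eta> where \<eta>: "\<eta> > 0" "\<And>\<zeta>. \<zeta> > 0 \<Longrightarrow> \<forall>\<^sub>F n in sequentially. \<forall>s\<ge>0. \<forall>t\<ge>s. t - s \<le> \<eta> \<longrightarrow>
        norm (w n t - w n s - (t - s) *\<^sub>R f (w n s)) \<le> 1 * (t - s) + \<zeta>"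
    using approximate_solutions_step[OF w zero_less_one] by blast
  \<comment> \<open>The slope \<open>M + 1\<close> is the drift bound plus the linear error rate 1.
    Over \<open>\<eta>'\<close> it costs half of \<open>\<epsilon>\<close>; the other half is left
    for the additive error.\<close>
  define \<eta>' where "\<eta>' = min \<eta> (\<epsilon> / (2 * (M + 1)))"
  have "(M + 1) * \<eta>' \<le> (M + 1) * (\<epsilon> / (2 * (M + 1)))"
    using M(1) unfolding \<eta>'_def by (intro mult_left_mono) auto
  also have "\<dots> = \<epsilon> / 2" using M(1) by (simp add: field_simps)
  finally have \<eta>': "\<eta>' \<le> \<eta>" "(M + 1) * \<eta>' \<le> \<epsilon> / 2" by (simp_all add: \<eta>'_def)
  have "\<forall>\<^sub>F n in sequentially. \<forall>s\<ge>0. \<forall>t\<ge>s. t - s \<le> \<eta> \<longrightarrow>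
        norm (w n t - w n s - (t - s) *\<^sub>R f (w n s)) \<le> 1 * (t - s) + \<epsilon> / 2"
    using \<eta>(2)[of "\<epsilon> / 2"] \<open>\<epsilon> > 0\<close> by simp
  then have "\<forall>\<^sub>F n in sequentially. \<forall>s\<ge>0. \<forall>t\<ge>0. \<bar>t - s\<bar> \<le> \<eta>' \<longrightarrow> dist (w n t) (w n s) \<le> \<epsilon>"
  proof eventually_elim
    case (elim n)
    have *: "dist (w n t) (w n s) \<le> \<epsilon>" if "s \<ge> 0" "t \<ge> s" "t - s \<le> \<eta>'" for s t
    proof -
      have "norm (w n t - w n s) \<le> norm (w n t - w n s - (t - s) *\<^sub>R f (w n s)) + norm ((t - s) *\<^sub>R f (w n s))"
        using norm_triangle_ineq[of "w n t - w n s - (t - s) *\<^sub>R f (w n s)"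
          "(t - s) *\<^sub>R f (w n s)"] by simp
      also have "\<dots> \<le> ((t - s) + \<epsilon> / 2) + (t - s) * M"
      proof (rule add_mono)
        show "norm (w n t - w n s - (t - s) *\<^sub>R f (w n s)) \<le> (t - s) + \<epsilon> / 2"
          using elim[rule_format, OF that(1,2)] that(3) \<eta>'(1) by simp
        show "norm ((t - s) *\<^sub>R f (w n s)) \<le> (t - s) * M"
          using M(2)[OF approximate_solutions_in[OF w \<open>s \<ge> 0\<close>, of n]] that(2)
          by (simp add: mult_left_mono)
      qed
      also have "\<dots> = (M + 1) * (t - s) + \<epsilon> / 2" by (simp add: algebra_simps)
      also have "\<dots> \<le> (M + 1) * \<eta>' + \<epsilon> / 2" using that M(1) by (intro add_mono mult_left_mono) auto
      also have "\<dots> \<le> \<epsilon>" using \<eta>' by simp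
      finally show ?thesis by (simp add: dist_norm)
    qed
    have "dist (w n t) (w n s) \<le> \<epsilon>" if "s \<ge> 0" "t \<ge> 0" "\<bar>t - s\<bar> \<le> \<eta>'" for s t
      using *[of s t] *[of t s] that by (cases "s \<le> t") (auto simp: dist_commute)
    then show ?case by blast
  qed
  moreover have "\<eta>' > 0" using \<eta>(1) M(1) \<open>\<epsilon> > 0\<close> by (simp add: \<eta>'_def)
  ultimately show ?thesis using that by blast
qed

text \<open>Forward increments give the right derivative at once. To the left of \<open>t\<close>
  the estimate is anchored at the earlier time \<open>s\<close>, so \<open>f (\<phi> s)\<close> must
  be exchanged for \<open>f (\<phi> t)\<close>, which takes continuity of \<open>\<phi>\<close> and
  uniform continuity of \<open>f\<close>.\<close>

lemma ode_solution_if_uniform_increments: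
  assumes S: "compact S" "continuous_on S f"
    and "\<phi> 0 = u0" and inS: "\<And>t. t \<ge> 0 \<Longrightarrow> \<phi> t \<in> S"
    and incr: "\<And>\<epsilon>. \<epsilon> > 0 \<Longrightarrow> \<exists>\<eta>>0. \<forall>s\<ge>0. \<forall>t\<ge>s. t - s \<le> \<eta> \<longrightarrow>
        norm (\<phi> t - \<phi> s - (t - s) *\<^sub>R f (\<phi> s)) \<le> \<epsilon> * (t - s)"
  shows "ode_solution S f u0 \<phi>"
proof -
  \<comment> \<open>Viewed as a constant sequence, \<open>\<phi>\<close> inherits uniform continuity
    from the equicontinuity of approximate solutions.\<close>
  have "approximate_solutions S f (\<lambda>_. \<phi>)"
    unfolding approximate_solutions_def
  proof (intro conjI allI impI)
    fix \<epsilon> :: real assume "\<epsilon> > 0"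
    from incr[OF this] obtain \<eta> where \<eta>: "\<eta> > 0" "\<And>s t. s \<ge> 0 \<Longrightarrow> t \<ge> s \<Longrightarrow> t - s \<le> \<eta> \<Longrightarrow>
        norm (\<phi> t - \<phi> s - (t - s) *\<^sub>R f (\<phi> s)) \<le> \<epsilon> * (t - s)"
      by blast
    have "norm (\<phi> t - \<phi> s - (t - s) *\<^sub>R f (\<phi> s)) \<le> \<epsilon> * (t - s) + \<zeta>"
      if "\<zeta> > 0" "s \<ge> 0" "t \<ge> s" "t - s \<le> \<eta>" for \<zeta> s t
      using \<eta>(2)[OF that(2-)] that(1) by linarith
    then show "\<exists>\<eta>>0. \<forall>\<zeta>>0. \<forall>\<^sub>F n in sequentially. \<forall>s\<ge>0. \<forall>t\<ge>s. t - s \<le> \<eta> \<longrightarrow>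
        norm (\<phi> t - \<phi> s - (t - s) *\<^sub>R f (\<phi> s)) \<le> \<epsilon> * (t - s) + \<zeta>"
      using \<eta>(1) by (intro exI[of _ \<eta>] conjI allI impI always_eventually) auto
  qed (use inS in auto)
  note equi = approximate_solutions_equicontinuous[OF this S]
  have unif: "uniformly_continuous_on S f" using compact_uniformly_continuous[OF S(2,1)] .
  have "(\<phi> has_vector_derivative f (\<phi> t)) (at t within {0..})" if "t \<ge> 0" for t
    unfolding has_vector_derivative_def has_derivative_within_alt
  proof (intro conjI allI impI)
    show "bounded_linear (\<lambda>x. x *\<^sub>R f (\<phi> t))" by (rule bounded_linear_scaleR_left)
    fix \<epsilon> :: real assume "\<epsilon> > 0"
    then obtain \<delta> where \<delta>: "\<delta> > 0" "\<And>u v. u \<in> S \<Longrightarrow> v \<in> S \<Longrightarrow> dist u v < \<delta> \<Longrightarrow> dist (f u) (f v) < \<epsilon> / 2"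
      using unif unfolding uniformly_continuous_on_def by (metis half_gt_zero)
    have half: "\<delta> / 2 > 0" "\<epsilon> / 2 > 0" using \<delta>(1) \<open>\<epsilon> > 0\<close> by auto
    obtain \<eta>1 where \<eta>1: "\<eta>1 > 0" "\<forall>\<^sub>F n in sequentially. \<forall>s\<ge>0. \<forall>t\<ge>0. \<bar>t - s\<bar> \<le> \<eta>1 \<longrightarrow>
        dist (\<phi> t) (\<phi> s) \<le> \<delta> / 2"
      by (rule equi[OF half(1)])
    note \<eta>1(2)[unfolded eventually_const[OF sequentially_bot], rule_format]
    note \<eta>1 = \<eta>1(1) this
    from incr[OF half(2)] obtain \<eta>2 where \<eta>2: "\<eta>2 > 0" "\<And>s t. s \<ge> 0 \<Longrightarrow> t \<ge> s \<Longrightarrow> t - s \<le> \<eta>2 \<Longrightarrow>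
        norm (\<phi> t - \<phi> s - (t - s) *\<^sub>R f (\<phi> s)) \<le> \<epsilon> / 2 * (t - s)"
      by blast
    have "norm (\<phi> s - \<phi> t - (s - t) *\<^sub>R f (\<phi> t)) \<le> \<epsilon> * norm (s - t)"
      if "s \<in> {0..}" "norm (s - t) < min \<eta>1 \<eta>2" for s
    proof (cases "s \<le> t")
      case False
      then have "norm (\<phi> s - \<phi> t - (s - t) *\<^sub>R f (\<phi> t)) \<le> \<epsilon> / 2 * (s - t)"
        using \<eta>2(2)[of t s] that \<open>t \<ge> 0\<close> by auto
      also have "\<dots> \<le> \<epsilon> * norm (s - t)" using False \<open>\<epsilon> > 0\<close> by auto
      finally show ?thesis .
    next
      case True
      have "dist (\<phi> s) (\<phi> t) \<le> \<delta> / 2"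
        using \<eta>1(2)[of t s] that \<open>t \<ge> 0\<close> by simp
      then have "dist (\<phi> s) (\<phi> t) < \<delta>" using \<delta>(1) by simp
      then have 1: "norm (f (\<phi> s) - f (\<phi> t)) \<le> \<epsilon> / 2"
        using \<delta>(2) inS that(1) \<open>t \<ge> 0\<close> by (force simp: dist_norm)
      have "norm (\<phi> s - \<phi> t - (s - t) *\<^sub>R f (\<phi> t))
          = norm (- (\<phi> t - \<phi> s - (t - s) *\<^sub>R f (\<phi> s)) - (t - s) *\<^sub>R (f (\<phi> s) - f (\<phi> t)))"
        by (rule arg_cong[where f = norm]) (simp add: algebra_simps)
      also have "\<dots> \<le> norm (\<phi> t - \<phi> s - (t - s) *\<^sub>R f (\<phi> s)) + norm ((t - s) *\<^sub>R (f (\<phi> s) - f (\<phi> t)))"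
        by (metis norm_triangle_ineq4 norm_minus_cancel)
      also have "\<dots> \<le> \<epsilon> / 2 * (t - s) + (t - s) * (\<epsilon> / 2)"
        using \<eta>2(2)[of s t] that True mult_left_mono[OF 1, of "t - s"]
        by (intro add_mono) auto
      also have "\<dots> = \<epsilon> * norm (s - t)" using True by (simp add: field_simps)
      finally show ?thesis .
    qed
    then show "\<exists>d>0. \<forall>y\<in>{0..}. norm (y - t) < d \<longrightarrow>
        norm (\<phi> y - \<phi> t - (y - t) *\<^sub>R f (\<phi> t)) \<le> \<epsilon> * norm (y - t)"
      using \<eta>1(1) \<eta>2(1) by (intro exI[of _ "min \<eta>1 \<eta>2"]) auto
  qed
  then show ?thesis using assms(3) inS unfolding ode_solution_def by blast
qed

section \<open>The flow of a uniquely solvable equation, and limits of approximate solutions\<close>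

lemma ode_flow_solution:
  assumes "unique_solutions_in S f" "u0 \<in> S"
  shows "ode_solution S f u0 (\<lambda>t. ode_flow S f t u0)"
proof -
  have "\<exists>\<phi>. ode_solution S f u0 \<phi>" using assms unfolding unique_solutions_in_def by blast
  then have "ode_solution S f u0 (SOME \<phi>. ode_solution S f u0 \<phi>)" by (rule someI_ex)
  then show ?thesis unfolding ode_flow_def .
qed

lemma ode_flow_eqI:
  assumes "unique_solutions_in S f" "u0 \<in> S" "ode_solution S f u0 \<phi>" "t \<ge> 0"
  shows "ode_flow S f t u0 = \<phi> t"
  using assms ode_flow_solution[OF assms(1,2)] unfolding unique_solutions_in_def by metis

lemma ode_flow_in: "unique_solutions_in S f \<Longrightarrow> u0 \<in> S \<Longrightarrow> t \<ge> 0 \<Longrightarrow> ode_flow S f t u0 \<in> S"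
  using ode_flow_solution unfolding ode_solution_def by blast

lemma ode_flow_0: "unique_solutions_in S f \<Longrightarrow> u0 \<in> S \<Longrightarrow> ode_flow S f 0 u0 = u0"
  using ode_flow_solution unfolding ode_solution_def by blast

text \<open>An Arzela-Ascoli argument: a diagonal subsequence converges at all rational times, hence
  locally uniformly, and its limit is a solution of the differential equation.\<close>
lemma approximate_solutions_subsequence:
  fixes f :: "'a::banach \<Rightarrow> 'a"
  assumes S: "compact S" "continuous_on S f" and uniq: "unique_solutions_in S f"
    and w: "approximate_solutions S f w" and w0: "(\<lambda>n. w n 0) \<longlonglongrightarrow> u0"
  obtains r where "strict_mono (r::nat \<Rightarrow> nat)"
    "\<And>\<sigma> s. \<sigma> \<longlonglongrightarrow> s \<Longrightarrow> (\<And>n. \<sigma> n \<ge> 0) \<Longrightarrow> (\<lambda>n. w (r n) (\<sigma> n)) \<longlonglongrightarrow> ode_flow S f s u0"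
proof -
  \<comment> \<open>The absolute value turns every rational into an admissible time, so that the
    values lie in \<open>S\<close> for all indices.\<close>
  have "\<And>n q. w n \<bar>real_of_rat q\<bar> \<in> S" using approximate_solutions_in[OF w] by simp
  from diagonal_convergent_subsequence[OF S(1), of "\<lambda>n q. w n \<bar>real_of_rat q\<bar>", OF this]
  obtain r where r: "strict_mono (r::nat \<Rightarrow> nat)"
    and conv: "\<And>q. convergent (\<lambda>n. w (r n) \<bar>real_of_rat q\<bar>)" by blast
  define v where "v n = w (r n)" for n
  have v: "approximate_solutions S f v"
    unfolding v_def by (rule approximate_solutions_reindex[OF w filterlim_subseq[OF r]])
  note inS = approximate_solutions_in[OF v]
  have Cauchy_v: "Cauchy (\<lambda>n. v n s)" if "s \<ge> 0" for s
  proof (rule metric_CauchyI)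
    fix \<epsilon> :: real assume "\<epsilon> > 0"
    then obtain \<eta> where \<eta>: "\<eta> > 0" "\<forall>\<^sub>F n in sequentially. \<forall>s\<ge>0. \<forall>t\<ge>0. \<bar>t - s\<bar> \<le> \<eta> \<longrightarrow>
        dist (v n t) (v n s) \<le> \<epsilon> / 4"
      using approximate_solutions_equicontinuous[OF v S, of "\<epsilon> / 4"] by auto
    \<comment> \<open>A rational time just above \<open>s\<close> is automatically nonnegative;
      convergence there is carried over to \<open>s\<close> by equicontinuity.\<close>
    obtain q where q: "s < real_of_rat q" "real_of_rat q < s + \<eta>"
      using of_rat_dense[of s "s + \<eta>"] \<eta>(1) by auto
    have "\<bar>real_of_rat q\<bar> = real_of_rat q" using q \<open>s \<ge> 0\<close> by linarith
    with convergent_Cauchy[OF conv[of q]] have "Cauchy (\<lambda>n. v n (real_of_rat q))"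
      unfolding v_def by metis
    then obtain N1 where N1: "\<And>m n. m \<ge> N1 \<Longrightarrow> n \<ge> N1 \<Longrightarrow>
        dist (v m (real_of_rat q)) (v n (real_of_rat q)) < \<epsilon> / 4"
      using metric_CauchyD[of "\<lambda>n. v n (real_of_rat q)" "\<epsilon> / 4"] \<open>\<epsilon> > 0\<close> by auto
    have "\<bar>real_of_rat q - s\<bar> \<le> \<eta>" "real_of_rat q \<ge> 0" using q \<open>s \<ge> 0\<close> by linarith+
    then have "\<forall>\<^sub>F n in sequentially. dist (v n (real_of_rat q)) (v n s) \<le> \<epsilon> / 4"
      using \<eta>(2) \<open>s \<ge> 0\<close> by (auto elim: eventually_mono)
    then obtain N2 where N2: "\<And>n. n \<ge> N2 \<Longrightarrow> dist (v n (real_of_rat q)) (v n s) \<le> \<epsilon> / 4"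
      unfolding eventually_sequentially by blast
    have "dist (v m s) (v n s) < \<epsilon>" if "m \<ge> max N1 N2" "n \<ge> max N1 N2" for m n
    proof -
      have "dist (v m s) (v n s) \<le> dist (v m (real_of_rat q)) (v m s)
          + dist (v m (real_of_rat q)) (v n (real_of_rat q)) + dist (v n (real_of_rat q)) (v n s)"
        using dist_triangle[of "v m s" "v n s" "v m (real_of_rat q)"]
          dist_triangle[of "v m (real_of_rat q)" "v n s" "v n (real_of_rat q)"]
        by (simp add: dist_commute)
      then show ?thesis using N1[of m n] N2[of m] N2[of n] that \<open>\<epsilon> > 0\<close> by simp
    qed
    then show "\<exists>M. \<forall>m\<ge>M. \<forall>n\<ge>M. dist (v m s) (v n s) < \<epsilon>" by blast
  qed
  define \<phi> where "\<phi> s = lim (\<lambda>n. v n s)" for s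
  have lim\<phi>: "(\<lambda>n. v n s) \<longlonglongrightarrow> \<phi> s" if "s \<ge> 0" for s
    using Cauchy_v[OF that] unfolding \<phi>_def by (simp add: Cauchy_convergent convergent_LIMSEQ_iff[symmetric])
  have \<phi>S: "\<phi> s \<in> S" if "s \<ge> 0" for s
    using closed_sequentially[OF compact_imp_closed[OF S(1)] _ lim\<phi>[OF that]] inS[OF that] by blast
  have sol: "ode_solution S f u0 \<phi>"
  proof (rule ode_solution_if_uniform_increments[OF S _ \<phi>S])
    show "\<phi> 0 = u0"
      using LIMSEQ_subseq_LIMSEQ[OF w0 r] lim\<phi>[of 0] LIMSEQ_unique unfolding v_def o_def by auto
    fix \<epsilon> :: real assume "\<epsilon> > 0"
    then obtain \<eta> where \<eta>: "\<eta> > 0" "\<And>\<zeta>. \<zeta> > 0 \<Longrightarrow> \<forall>\<^sub>F n in sequentially. \<forall>s\<ge>0. \<forall>t\<ge>s. t - s \<le> \<eta> \<longrightarrow>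
        norm (v n t - v n s - (t - s) *\<^sub>R f (v n s)) \<le> \<epsilon> * (t - s) + \<zeta>"
      using approximate_solutions_step[OF v] by blast
    have "norm (\<phi> t - \<phi> s - (t - s) *\<^sub>R f (\<phi> s)) \<le> \<epsilon> * (t - s)"
      if "s \<ge> 0" "t \<ge> s" "t - s \<le> \<eta>" for s t
    proof (rule field_le_epsilon)
      \<comment> \<open>Since \<open>\<eta>\<close> does not depend on \<open>\<zeta>\<close>, one
        may let \<open>n\<close> tend to infinity at fixed \<open>\<zeta>\<close> and afterwards let
        \<open>\<zeta>\<close> tend to 0; the additive error disappears in the limit.\<close>
      fix \<zeta> :: real assume "\<zeta> > 0"
      have "\<forall>\<^sub>F n in sequentially. norm (v n t - v n s - (t - s) *\<^sub>R f (v n s)) \<le> \<epsilon> * (t - s) + \<zeta>"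
        using \<eta>(2)[OF \<open>\<zeta> > 0\<close>] by eventually_elim (use that in auto)
      moreover have "(\<lambda>n. norm (v n t - v n s - (t - s) *\<^sub>R f (v n s)))
          \<longlonglongrightarrow> norm (\<phi> t - \<phi> s - (t - s) *\<^sub>R f (\<phi> s))"
        using that \<phi>S inS lim\<phi>
        by (intro tendsto_intros continuous_on_tendsto_compose[OF S(2)]) auto
      ultimately show "norm (\<phi> t - \<phi> s - (t - s) *\<^sub>R f (\<phi> s)) \<le> \<epsilon> * (t - s) + \<zeta>"
        by (intro tendsto_upperbound) auto
    qed
    then show "\<exists>\<eta>>0. \<forall>s\<ge>0. \<forall>t\<ge>s. t - s \<le> \<eta> \<longrightarrow>
        norm (\<phi> t - \<phi> s - (t - s) *\<^sub>R f (\<phi> s)) \<le> \<epsilon> * (t - s)" using \<eta>(1) by blast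
  qed auto
  have "u0 \<in> S" using sol \<phi>S[of 0] unfolding ode_solution_def by simp
  have "(\<lambda>n. w (r n) (\<sigma> n)) \<longlonglongrightarrow> ode_flow S f s u0"
    if \<sigma>: "\<sigma> \<longlonglongrightarrow> s" "\<And>n. \<sigma> n \<ge> 0" for \<sigma> :: "nat \<Rightarrow> real" and s
  proof -
    have "s \<ge> 0" using \<sigma> by (meson LIMSEQ_le_const)
    \<comment> \<open>Equicontinuity lets the time move with \<open>n\<close>. Later compactness
      arguments extract limits of starting points and elapsed times simultaneously.\<close>
    have "(\<lambda>n. dist (v n (\<sigma> n)) (v n s)) \<longlonglongrightarrow> 0"
    proof (rule LIMSEQ_I)
      fix \<epsilon> :: real assume "\<epsilon> > 0"
      then obtain \<eta> where \<eta>: "\<eta> > 0" "\<forall>\<^sub>F n in sequentially. \<forall>s\<ge>0. \<forall>t\<ge>0. \<bar>t - s\<bar> \<le> \<eta> \<longrightarrow>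
        dist (v n t) (v n s) \<le> \<epsilon> / 2"
        using approximate_solutions_equicontinuous[OF v S, of "\<epsilon> / 2"] by auto
      have "\<forall>\<^sub>F n in sequentially. dist (\<sigma> n) s < \<eta>"
        using \<sigma>(1) \<eta>(1) by (auto simp: tendsto_iff)
      with \<eta>(2) have "\<forall>\<^sub>F n in sequentially. norm (dist (v n (\<sigma> n)) (v n s) - 0) < \<epsilon>"
        
      proof eventually_elim
        case (elim n)
        then have "dist (v n (\<sigma> n)) (v n s) \<le> \<epsilon> / 2"
          using \<open>s \<ge> 0\<close> \<sigma>(2)[of n] by (simp add: dist_real_def)
        then show ?case using \<open>\<epsilon> > 0\<close> by simp
      qed
      then show "\<exists>N. \<forall>n\<ge>N. norm (dist (v n (\<sigma> n)) (v n s) - 0) < \<epsilon>"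
        unfolding eventually_sequentially .
    qed
    then have "(\<lambda>n. v n (\<sigma> n) - v n s) \<longlonglongrightarrow> 0"
      unfolding dist_norm by (rule tendsto_norm_zero_cancel)
    then have "(\<lambda>n. v n (\<sigma> n)) \<longlonglongrightarrow> \<phi> s"
      by (rule Lim_transform[OF lim\<phi>[OF \<open>s \<ge> 0\<close>]])
    then show ?thesis
      unfolding v_def ode_flow_eqI[OF uniq \<open>u0 \<in> S\<close> sol \<open>s \<ge> 0\<close>] .
  qed
  then show ?thesis using that r by blast
qed

section \<open>Convergence of whole sequences and continuity of the flow\<close>

lemma frequently_sequentially_subseq:
  assumes "\<exists>\<^sub>F n in sequentially. P n"
  obtains r where "strict_mono (r::nat \<Rightarrow> nat)" "\<And>n. P (r n)"
proof -
  have "infinite {n. P n}"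
    using assms by (simp add: frequently_cofinite cofinite_eq_sequentially[symmetric])
  then show ?thesis using infinite_enumerate[of "{n. P n}"] that by blast
qed

lemma not_tendsto_subseq:
  fixes v :: "nat \<Rightarrow> 'a::metric_space"
  assumes "\<not> v \<longlonglongrightarrow> l"
  obtains \<epsilon> r where "\<epsilon> > 0" "strict_mono (r::nat \<Rightarrow> nat)" "\<And>n. dist (v (r n)) l \<ge> \<epsilon>"
proof -
  obtain \<epsilon> where "\<epsilon> > 0" "\<exists>\<^sub>F n in sequentially. \<not> dist (v n) l < \<epsilon>"
    using assms unfolding tendsto_iff not_eventually[symmetric] by blast
  then show ?thesis using frequently_sequentially_subseq[of "\<lambda>n. \<not> dist (v n) l < \<epsilon>"] that
    by (metis not_less)
qed

text \<open>A Heine-Cantor theorem in which only one of the two points is confined to a compact set.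
  It is meant for semiflows on an arbitrary state space that are compared with iterates in a compact
  part of it.\<close>

lemma continuous_on_uniform_near_compact:
  fixes g :: "'a::metric_space \<Rightarrow> 'b::metric_space"
  assumes "continuous_on A g" "compact K" "K \<subseteq> A" "\<epsilon> > 0"
  obtains \<delta> where "\<delta> > 0" "\<And>x y. x \<in> K \<Longrightarrow> y \<in> A \<Longrightarrow> dist y x < \<delta> \<Longrightarrow> dist (g y) (g x) < \<epsilon>"
proof (rule ccontr)
  assume neg: "\<not> thesis"
  have "\<exists>x y. x \<in> K \<and> y \<in> A \<and> dist y x < inverse (real (Suc n)) \<and> dist (g y) (g x) \<ge> \<epsilon>" for n
    using neg that[of "inverse (real (Suc n))"] by (force simp: not_less)
  then obtain x y where xy: "\<And>n. x n \<in> K" "\<And>n. y n \<in> A"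
      "\<And>n. dist (y n) (x n) < inverse (real (Suc n))" "\<And>n. dist (g (y n)) (g (x n)) \<ge> \<epsilon>"
    by metis
  obtain l r where l: "l \<in> K" and r: "strict_mono (r::nat \<Rightarrow> nat)" and xl: "(x \<circ> r) \<longlonglongrightarrow> l"
    using assms(2) xy(1) unfolding compact_def by metis
  have "(\<lambda>n. dist (y n) (x n)) \<longlonglongrightarrow> 0"
    by (rule tendsto_sandwich[OF _ _ tendsto_const LIMSEQ_inverse_real_of_nat])
      (use xy(3) in \<open>auto intro!: always_eventually less_imp_le\<close>)
  from LIMSEQ_subseq_LIMSEQ[OF this r] have "(\<lambda>n. dist (y (r n)) (x (r n))) \<longlonglongrightarrow> 0"
    by (simp add: o_def)
  moreover have "(\<lambda>n. dist (x (r n)) l) \<longlonglongrightarrow> 0"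
    using xl[THEN tendsto_dist_iff[THEN iffD1]] by (simp add: o_def)
  ultimately have "(\<lambda>n. dist (y (r n)) (x (r n)) + dist (x (r n)) l) \<longlonglongrightarrow> 0"
    using tendsto_add_zero by blast
  then have "(\<lambda>n. dist (y (r n)) l) \<longlonglongrightarrow> 0"
    by (rule tendsto_sandwich[OF _ _ tendsto_const, rotated 2]) (auto intro!: always_eventually dist_triangle)
  then have yl: "(\<lambda>n. y (r n)) \<longlonglongrightarrow> l" by (rule tendsto_dist_iff[THEN iffD2])
  have "l \<in> A" "\<And>n. x n \<in> A" using l xy(1) assms(3) by auto
  then have "(\<lambda>n. g (y (r n))) \<longlonglongrightarrow> g l" "(\<lambda>n. g (x (r n))) \<longlonglongrightarrow> g l"
    using xl xy(2) by (auto intro!: continuous_on_tendsto_compose[OF assms(1)] yl simp: o_def)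
  then have "(\<lambda>n. dist (g (y (r n))) (g (x (r n)))) \<longlonglongrightarrow> dist (g l) (g l)"
    by (rule tendsto_dist)
  then have "\<epsilon> \<le> dist (g l) (g l)"
    by (rule LIMSEQ_le_const) (use xy(4) in auto)
  then show False using \<open>\<epsilon> > 0\<close> by simp
qed

text \<open>Uniqueness of solutions makes the limit independent of the subsequence: any subsequence
  staying away from it would have a further subsequence converging to it.\<close>

lemma approximate_solutions_tendsto:
  fixes f :: "'a::banach \<Rightarrow> 'a"
  assumes S: "compact S" "continuous_on S f" and uniq: "unique_solutions_in S f"
    and w: "approximate_solutions S f w" and w0: "(\<lambda>n. w n 0) \<longlonglongrightarrow> u0"
    and \<sigma>: "\<sigma> \<longlonglongrightarrow> s" "\<And>n. \<sigma> n \<ge> 0"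
  shows "(\<lambda>n. w n (\<sigma> n)) \<longlonglongrightarrow> ode_flow S f s u0"
proof (rule ccontr)
  assume "\<not> ?thesis"
  then obtain \<epsilon> q where q: "\<epsilon> > 0" "strict_mono (q::nat \<Rightarrow> nat)"
      "\<And>n. dist (w (q n) (\<sigma> (q n))) (ode_flow S f s u0) \<ge> \<epsilon>"
    using not_tendsto_subseq by blast
  have w0q: "(\<lambda>n. w (q n) 0) \<longlonglongrightarrow> u0"
    using LIMSEQ_subseq_LIMSEQ[OF w0 q(2)] by (simp add: o_def)
  obtain r where r: "strict_mono (r::nat \<Rightarrow> nat)" "\<And>\<sigma> s. \<sigma> \<longlonglongrightarrow> s \<Longrightarrow> (\<And>n. \<sigma> n \<ge> 0) \<Longrightarrow>
      (\<lambda>n. w (q (r n)) (\<sigma> n)) \<longlonglongrightarrow> ode_flow S f s u0"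
    using approximate_solutions_subsequence[OF S uniq
        approximate_solutions_reindex[OF w filterlim_subseq[OF q(2)]] w0q] by blast
  have "(\<lambda>n. \<sigma> (q (r n))) \<longlonglongrightarrow> s"
    using LIMSEQ_subseq_LIMSEQ[OF \<sigma>(1) strict_mono_o[OF q(2) r(1)]] by (simp add: o_def)
  from r(2)[OF this \<sigma>(2)]
  have "(\<lambda>n. dist (w (q (r n)) (\<sigma> (q (r n)))) (ode_flow S f s u0)) \<longlonglongrightarrow> 0"
    by (rule tendsto_dist_iff[THEN iffD1])
  then have "\<epsilon> \<le> 0" by (rule LIMSEQ_le_const) (use q(3) in auto)
  then show False using q(1) by simp
qed

text \<open>The mean value inequality is used twice: a crude bound keeps the solution within
  \<open>\<delta>\<close> of \<open>\<phi> s\<close>, and there uniform continuity of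
  \<open>f\<close> improves the slope to \<open>\<epsilon>\<close>. The threshold
  \<open>\<eta>\<close> serves all solutions at once.\<close>

lemma ode_solution_increments:
  fixes f :: "'a::real_normed_vector \<Rightarrow> 'a"
  assumes S: "compact S" "continuous_on S f" and "\<epsilon> > 0"
  obtains \<eta> where "\<eta> > 0" "\<And>\<phi> u0 s t. ode_solution S f u0 \<phi> \<Longrightarrow> 0 \<le> s \<Longrightarrow> s \<le> t \<Longrightarrow> t - s \<le> \<eta> \<Longrightarrow>
    norm (\<phi> t - \<phi> s - (t - s) *\<^sub>R f (\<phi> s)) \<le> \<epsilon> * (t - s)"
proof -
  obtain M where M: "M > 0" "\<And>u. u \<in> S \<Longrightarrow> norm (f u) \<le> M"
    using continuous_on_compact_norm_bound[OF S] by blast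
  obtain \<delta> where \<delta>: "\<delta> > 0" "\<And>u v. u \<in> S \<Longrightarrow> v \<in> S \<Longrightarrow> dist u v < \<delta> \<Longrightarrow> dist (f u) (f v) < \<epsilon>"
    using compact_uniformly_continuous[OF S(2,1)] \<open>\<epsilon> > 0\<close>
    unfolding uniformly_continuous_on_def by metis
  have "norm (\<phi> t - \<phi> s - (t - s) *\<^sub>R f (\<phi> s)) \<le> \<epsilon> * (t - s)"
    if sol: "ode_solution S f u0 \<phi>" and st: "0 \<le> s" "s \<le> t" "t - s \<le> \<delta> / (4 * M)" for \<phi> u0 s t
  proof -
    have inS: "\<phi> r \<in> S" if "r \<ge> 0" for r using sol that unfolding ode_solution_def by blast
    have deriv: "(\<phi> has_vector_derivative f (\<phi> r)) (at r within A)" if "r \<in> A" "A \<subseteq> {0..}" for r A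
      using sol that has_vector_derivative_within_subset[of \<phi> "f (\<phi> r)" r "{0..}" A]
      unfolding ode_solution_def by auto
    have near: "dist (\<phi> r) (\<phi> s) < \<delta>" if r: "r \<in> {s..t}" for r
    proof -
      \<comment> \<open>Deviation from the tangent has slope \<open>2 * M\<close> and the tangent
        itself \<open>M\<close>. Over a length of at most \<open>\<delta> / (4 * M)\<close> this
        gives a displacement of at most three quarters of \<open>\<delta>\<close>.\<close>
      have "norm (\<phi> r - \<phi> s - (r - s) *\<^sub>R f (\<phi> s)) \<le> norm (r - s) * (2 * M)"
      proof (rule vector_differentiable_bound_linearization[where S = "{s..r}"])
        fix x assume "x \<in> {s..r}"
        then have "norm (f (\<phi> x)) \<le> M" "norm (f (\<phi> s)) \<le> M" using M(2) inS st by auto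
        then show "norm (f (\<phi> x) - f (\<phi> s)) \<le> 2 * M"
          using norm_triangle_ineq4[of "f (\<phi> x)" "f (\<phi> s)"] by linarith
      qed (use deriv st r in \<open>auto simp: closed_segment_eq_real_ivl\<close>)
      moreover have "norm ((r - s) *\<^sub>R f (\<phi> s)) \<le> (r - s) * M"
        using M(2)[OF inS[OF st(1)]] r by (auto intro: mult_left_mono)
      moreover have "norm (\<phi> r - \<phi> s) \<le> norm (\<phi> r - \<phi> s - (r - s) *\<^sub>R f (\<phi> s)) + norm ((r - s) *\<^sub>R f (\<phi> s))"
        using norm_triangle_ineq[of "\<phi> r - \<phi> s - (r - s) *\<^sub>R f (\<phi> s)" "(r - s) *\<^sub>R f (\<phi> s)"] by simp
      ultimately have "norm (\<phi> r - \<phi> s) \<le> (r - s) * (3 * M)"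
        using r by (auto simp: algebra_simps)
      also have "\<dots> \<le> \<delta> / (4 * M) * (3 * M)"
        using r st M(1) by (intro mult_right_mono) auto
      also have "\<dots> < \<delta>" using M(1) \<delta>(1) by (simp add: field_simps)
      finally show ?thesis by (simp add: dist_norm)
    qed
    have "norm (\<phi> t - \<phi> s - (t - s) *\<^sub>R f (\<phi> s)) \<le> norm (t - s) * \<epsilon>"
    proof (rule vector_differentiable_bound_linearization[where S = "{s..t}"])
      fix x assume x: "x \<in> {s..t}"
      then have "dist (f (\<phi> x)) (f (\<phi> s)) < \<epsilon>" using near st by (intro \<delta>(2) inS) auto
      then show "norm (f (\<phi> x) - f (\<phi> s)) \<le> \<epsilon>" by (simp add: dist_norm)
    qed (use deriv st in \<open>auto simp: closed_segment_eq_real_ivl\<close>)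
    then show ?thesis using st by (simp add: mult.commute)
  qed
  moreover have "\<delta> / (4 * M) > 0" using M(1) \<delta>(1) by simp
  ultimately show ?thesis using that by blast
qed

text \<open>Exact solutions with varying starting points form a sequence of approximate solutions,
  so joint continuity of the flow is a special case of the convergence result and requires no
  Lipschitz condition.\<close>

lemma ode_flow_tendsto:
  fixes f :: "'a::banach \<Rightarrow> 'a"
  assumes S: "compact S" "continuous_on S f" and uniq: "unique_solutions_in S f"
    and u: "u \<longlonglongrightarrow> u0" "\<And>n. u n \<in> S" and \<sigma>: "\<sigma> \<longlonglongrightarrow> s" "\<And>n. \<sigma> n \<ge> 0"
  shows "(\<lambda>n. ode_flow S f (\<sigma> n) (u n)) \<longlonglongrightarrow> ode_flow S f s u0"
proof (rule approximate_solutions_tendsto[OF S uniq _ _ \<sigma>])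
  show "(\<lambda>n. ode_flow S f 0 (u n)) \<longlonglongrightarrow> u0"
    using u ode_flow_0[OF uniq] by simp
  show "approximate_solutions S f (\<lambda>n t. ode_flow S f t (u n))"
    unfolding approximate_solutions_def
  proof (intro conjI allI impI)
    fix \<epsilon> :: real assume "\<epsilon> > 0"
    then obtain \<eta> where \<eta>: "\<eta> > 0" "\<And>\<phi> u0 s t. ode_solution S f u0 \<phi> \<Longrightarrow> 0 \<le> s \<Longrightarrow> s \<le> t \<Longrightarrow> t - s \<le> \<eta> \<Longrightarrow>
        norm (\<phi> t - \<phi> s - (t - s) *\<^sub>R f (\<phi> s)) \<le> \<epsilon> * (t - s)"
      using ode_solution_increments[OF S] by blast
    have "norm (ode_flow S f t (u n) - ode_flow S f s (u n) - (t - s) *\<^sub>R f (ode_flow S f s (u n)))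
        \<le> \<epsilon> * (t - s) + \<zeta>" if "\<zeta> > 0" "0 \<le> s" "s \<le> t" "t - s \<le> \<eta>" for \<zeta> n s t
      using \<eta>(2)[OF ode_flow_solution[OF uniq u(2)] that(2-), of n] that(1) by linarith
    then show "\<exists>\<eta>>0. \<forall>\<zeta>>0. \<forall>\<^sub>F n in sequentially. \<forall>s\<ge>0. \<forall>t\<ge>s. t - s \<le> \<eta> \<longrightarrow>
        norm (ode_flow S f t (u n) - ode_flow S f s (u n) - (t - s) *\<^sub>R f (ode_flow S f s (u n)))
          \<le> \<epsilon> * (t - s) + \<zeta>"
      using \<eta>(1) by (intro exI[of _ \<eta>] conjI allI impI always_eventually) auto
  qed (use ode_flow_in[OF uniq u(2)] in auto)
qed

lemma ode_flow_add:
  assumes uniq: "unique_solutions_in S f" and "u \<in> S" "t \<ge> 0" "s \<ge> 0"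
  shows "ode_flow S f (t + s) u = ode_flow S f t (ode_flow S f s u)"
proof -
  let ?\<phi> = "\<lambda>t. ode_flow S f (t + s) u"
  have sol: "ode_solution S f u (\<lambda>t. ode_flow S f t u)" by (rule ode_flow_solution[OF assms(1,2)])
  have "(?\<phi> has_vector_derivative f (?\<phi> t)) (at t within {0..})" if "t \<ge> 0" for t
  proof -
    have "((\<lambda>t. t + s) has_vector_derivative 1) (at t within {0..})"
      by (auto intro!: derivative_eq_intros)
    moreover have "t + s \<ge> 0" "(\<lambda>t. t + s) ` {0..} \<subseteq> {0..}"
      using \<open>s \<ge> 0\<close> that by auto
    then have "((\<lambda>t. ode_flow S f t u) has_vector_derivative f (?\<phi> t))
        (at (t + s) within (\<lambda>t. t + s) ` {0..})"
      using sol has_vector_derivative_within_subset unfolding ode_solution_def by blast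
    ultimately show ?thesis
      using vector_diff_chain_within[of "\<lambda>t. t + s" 1 t "{0..}" "\<lambda>t. ode_flow S f t u" "f (?\<phi> t)"]
      unfolding o_def scaleR_one by blast
  qed
  then have "ode_solution S f (ode_flow S f s u) ?\<phi>"
    using ode_flow_in[OF uniq \<open>u \<in> S\<close>] \<open>s \<ge> 0\<close> unfolding ode_solution_def by simp
  from ode_flow_eqI[OF uniq ode_flow_in[OF uniq \<open>u \<in> S\<close> \<open>s \<ge> 0\<close>] this \<open>t \<ge> 0\<close>]
  show ?thesis by simp
qed

lemma semiflow_on_ode_flow:
  fixes f :: "'a::banach \<Rightarrow> 'a"
  assumes S: "compact S" "continuous_on S f" and uniq: "unique_solutions_in S f"
  shows "semiflow_on S (ode_flow S f)"
proof -
  have "continuous_on ({0..} \<times> S) (\<lambda>(t, x). ode_flow S f t x)"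
    unfolding continuous_on_sequentially
  proof (intro allI ballI impI)
    fix v p assume p: "p \<in> {0::real..} \<times> S" "(\<forall>n::nat. v n \<in> {0..} \<times> S) \<and> v \<longlonglongrightarrow> p"
    have "(\<lambda>n. ode_flow S f (fst (v n)) (snd (v n))) \<longlonglongrightarrow> ode_flow S f (fst p) (snd p)"
      using p by (intro ode_flow_tendsto[OF S uniq] tendsto_fst tendsto_snd) (auto simp: mem_Times_iff)
    then show "((\<lambda>(t, x). ode_flow S f t x) \<circ> v) \<longlonglongrightarrow> (\<lambda>(t, x). ode_flow S f t x) p"
      by (simp add: o_def case_prod_beta)
  qed
  then show ?thesis
    using ode_flow_in[OF uniq] ode_flow_0[OF uniq] ode_flow_add[OF uniq]
    unfolding semiflow_on_def by simp
qed

text \<open>Suppose that starting points \<open>v n\<close> are still far from \<open>p\<close> at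
  times \<open>t n\<close> tending to infinity, and let \<open>l\<close> be an accumulation point.
  The trajectory of \<open>l\<close> enters the stability ball at some time \<open>s\<close>; by
  continuity of the flow so do those of nearby \<open>v n\<close>, and stability holds them close to
  \<open>p\<close> ever after, including at \<open>t n\<close>.\<close>

lemma globally_attracting_uniformly:
  fixes f :: "'a::banach \<Rightarrow> 'a"
  assumes S: "compact S" "continuous_on S f" and uniq: "unique_solutions_in S f"
    and p: "globally_attracting_fixed_point S f p" and "\<epsilon> > 0"
  obtains T where "T \<ge> 0" "\<And>t v. t \<ge> T \<Longrightarrow> v \<in> S \<Longrightarrow> dist (ode_flow S f t v) p < \<epsilon>"
proof (rule ccontr)
  assume neg: "\<not> thesis"
  have "\<exists>t\<ge>real n. \<exists>v\<in>S. \<not> dist (ode_flow S f t v) p < \<epsilon>" for n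
    using neg that[of "real n"] by force
  then obtain t v where tv: "\<And>n. t n \<ge> real n" "\<And>n. v n \<in> S"
      "\<And>n. \<not> dist (ode_flow S f (t n) (v n)) p < \<epsilon>"
    by metis
  obtain \<delta> where \<delta>: "\<delta> > 0" "\<And>u \<phi> t. u \<in> S \<Longrightarrow> dist u p < \<delta> \<Longrightarrow> ode_solution S f u \<phi> \<Longrightarrow> t \<ge> 0 \<Longrightarrow>
      dist (\<phi> t) p < \<epsilon>"
    using p \<open>\<epsilon> > 0\<close> unfolding globally_attracting_fixed_point_def by blast
  obtain l r where l: "l \<in> S" and r: "strict_mono (r::nat \<Rightarrow> nat)" and vl: "(v \<circ> r) \<longlonglongrightarrow> l"
    using S(1) tv(2) unfolding compact_def by metis
  have "((\<lambda>t. ode_flow S f t l) \<longlongrightarrow> p) at_top"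
    using p l ode_flow_solution[OF uniq l] unfolding globally_attracting_fixed_point_def by blast
  then have "\<forall>\<^sub>F s in at_top. dist (ode_flow S f s l) p < \<delta>"
    using \<delta>(1) by (simp add: tendsto_iff)
  then have "\<forall>\<^sub>F s in at_top. s \<ge> 0 \<and> dist (ode_flow S f s l) p < \<delta>"
    using eventually_ge_at_top by (rule eventually_conj[rotated])
  then obtain s where s: "s \<ge> 0" "dist (ode_flow S f s l) p < \<delta>"
    using eventually_happens'[OF trivial_limit_at_top_linorder] by blast
  have "(\<lambda>n. ode_flow S f s (v (r n))) \<longlonglongrightarrow> ode_flow S f s l"
    using vl tv(2) s(1) by (intro ode_flow_tendsto[OF S uniq]) (auto simp: o_def)
  then have "(\<lambda>n. dist (ode_flow S f s (v (r n))) p) \<longlonglongrightarrow> dist (ode_flow S f s l) p"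
    by (intro tendsto_intros)
  then have "\<forall>\<^sub>F n in sequentially. dist (ode_flow S f s (v (r n))) p < \<delta>"
    using s(2) by (rule order_tendstoD(2))
  moreover have "\<forall>\<^sub>F n in sequentially. real n \<ge> s"
    using filterlim_real_sequentially by (simp add: filterlim_at_top)
  ultimately have "\<forall>\<^sub>F n in sequentially. dist (ode_flow S f s (v (r n))) p < \<delta> \<and> real n \<ge> s"
    by (rule eventually_conj)
  then obtain n where n: "dist (ode_flow S f s (v (r n))) p < \<delta>" "real n \<ge> s"
    using eventually_happens'[OF sequentially_bot] by blast
  have "t (r n) \<ge> s" using n(2) tv(1)[of "r n"] seq_suble[OF r, of n] by linarith
  then have "ode_flow S f (t (r n)) (v (r n)) = ode_flow S f (t (r n) - s) (ode_flow S f s (v (r n)))"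
    using ode_flow_add[OF uniq tv(2)[of "r n"], of "t (r n) - s" s] s(1) by simp
  moreover have "ode_flow S f s (v (r n)) \<in> S" by (rule ode_flow_in[OF uniq tv(2) s(1)])
  ultimately have "dist (ode_flow S f (t (r n)) (v (r n))) p < \<epsilon>"
    using \<delta>(2)[OF _ n(1) ode_flow_solution[OF uniq]] \<open>t (r n) \<ge> s\<close> by simp
  then show False using tv(3) by simp
qed

section \<open>Iterations with negligible noise\<close>

lemma tau_0 [simp]: "tau a 0 = 0"
  by (simp add: tau_def)

lemma tau_Suc [simp]: "tau a (Suc n) = tau a n + a (Suc n)"
  by (simp add: tau_def)

lemma tau_diff: "n \<le> k \<Longrightarrow> tau a k - tau a n = (\<Sum>j=n..<k. a (Suc j))"
  by (induction k rule: dec_induct) auto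

lemma recursion_diff:
  fixes u :: "nat \<Rightarrow> 'a::real_vector"
  assumes "\<And>n. u (Suc n) = u n + a (Suc n) *\<^sub>R h n" "n \<le> k"
  shows "u k - u n = (\<Sum>j=n..<k. a (Suc j) *\<^sub>R h j)"
  using assms(2) by (induction k rule: dec_induct) (auto simp: assms(1))

text \<open>The noise \<open>e j\<close> enters the step from \<open>j\<close> to \<open>Suc j\<close>, which has length \<open>a (Suc j)\<close>.\<close>
definition negligible_noise :: "(nat \<Rightarrow> real) \<Rightarrow> (nat \<Rightarrow> 'a::real_normed_vector) \<Rightarrow> bool" where
  "negligible_noise a e \<longleftrightarrow> (\<forall>T>0. \<forall>\<epsilon>>0. \<forall>\<^sub>F n in sequentially. \<forall>k\<ge>n.
     tau a k - tau a n \<le> T \<longrightarrow> norm (\<Sum>j=n..<k. a (Suc j) *\<^sub>R e j) \<le> \<epsilon>)"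

lemma negligible_noiseD:
  assumes "negligible_noise a e" "T > 0" "\<epsilon> > 0"
  shows "\<forall>\<^sub>F n in sequentially. \<forall>k\<ge>n. tau a k - tau a n \<le> T \<longrightarrow>
           norm (\<Sum>j=n..<k. a (Suc j) *\<^sub>R e j) \<le> \<epsilon>"
  using assms unfolding negligible_noise_def by blast

lemma negligible_noise_add:
  assumes "negligible_noise a e" "negligible_noise a e'"
  shows "negligible_noise a (\<lambda>n. e n + e' n)"
  unfolding negligible_noise_def
proof (intro allI impI)
  fix T \<epsilon> :: real assume "T > 0" "\<epsilon> > 0"
  then have "\<epsilon> / 2 > 0" by simp
  from negligible_noiseD[OF assms(1) \<open>T > 0\<close> this] negligible_noiseD[OF assms(2) \<open>T > 0\<close> this]
  show "\<forall>\<^sub>F n in sequentially. \<forall>k\<ge>n. tau a k - tau a n \<le> T \<longrightarrow>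
      norm (\<Sum>j=n..<k. a (Suc j) *\<^sub>R (e j + e' j)) \<le> \<epsilon>"
  proof eventually_elim
    case (elim n)
    have "norm (\<Sum>j=n..<k. a (Suc j) *\<^sub>R (e j + e' j)) \<le> \<epsilon>" if "k \<ge> n" "tau a k - tau a n \<le> T" for k
    proof -
      have "norm (\<Sum>j=n..<k. a (Suc j) *\<^sub>R (e j + e' j))
          \<le> norm (\<Sum>j=n..<k. a (Suc j) *\<^sub>R e j) + norm (\<Sum>j=n..<k. a (Suc j) *\<^sub>R e' j)"
        by (simp add: scaleR_add_right sum.distrib norm_triangle_ineq)
      also have "\<dots> \<le> \<epsilon> / 2 + \<epsilon> / 2"
        using elim(1)[rule_format, OF that] elim(2)[rule_format, OF that] by (rule add_mono)
      finally show ?thesis by simp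
    qed
    then show ?case by blast
  qed
qed

locale step_sizes =
  fixes a :: "nat \<Rightarrow> real"
  assumes pos: "n \<ge> 1 \<Longrightarrow> a n > 0"
    and tau_at_top: "filterlim (tau a) at_top sequentially"
    and tendsto_0: "a \<longlonglongrightarrow> 0"
begin

lemma Suc_pos [simp]: "a (Suc n) > 0"
  by (rule pos) simp

lemma strict_mono_tau: "strict_mono (tau a)"
  by (rule strict_mono_Suc_iff[THEN iffD2]) simp

lemma tau_mono: "n \<le> k \<Longrightarrow> tau a n \<le> tau a k"
  using strict_mono_less_eq[OF strict_mono_tau] by blast

lemma tau_nonneg [simp]: "tau a n \<ge> 0"
  using tau_mono[of 0 n] by simp

text \<open>This adjunction replaces the supremum in all later arguments. The supremum is attained
  because the set is finite, \<open>tau a\<close> being unbounded, and contains \<open>0\<close>,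
  \<open>t\<close> being nonnegative.\<close>

lemma le_clock_iff:
  assumes "t \<ge> 0"
  shows "k \<le> clock a t \<longleftrightarrow> tau a k \<le> t"
proof -
  let ?A = "{k. tau a k \<le> t}"
  obtain N where N: "\<And>n. n \<ge> N \<Longrightarrow> tau a n > t"
    using tau_at_top unfolding filterlim_at_top_dense eventually_sequentially by blast
  have "finite ?A" by (rule finite_subset[of _ "{..<N}"]) (use N in \<open>force simp: not_less[symmetric]\<close>)+
  moreover have "0 \<in> ?A" using assms by simp
  ultimately have eq: "clock a t = Max ?A"
    unfolding clock_def by (intro cSup_eq_Max) blast+
  have "Max ?A \<in> ?A" using \<open>finite ?A\<close> \<open>0 \<in> ?A\<close> by (intro Max_in) blast+
  then show ?thesis
    unfolding eq using tau_mono[of k "Max ?A"] Max_ge[OF \<open>finite ?A\<close>, of k] by auto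
qed

lemma clock_le: "t \<ge> 0 \<Longrightarrow> tau a (clock a t) \<le> t"
  using le_clock_iff[of t "clock a t"] by simp

lemma clock_gt: "t \<ge> 0 \<Longrightarrow> t < tau a (clock a t) + a (Suc (clock a t))"
  using le_clock_iff[of t "Suc (clock a t)"] by simp

lemma clock_tau [simp]: "clock a (tau a n) = n"
  using clock_le[OF tau_nonneg, of n] le_clock_iff[OF tau_nonneg, of n n]
    strict_mono_less_eq[OF strict_mono_tau] by (intro antisym) simp_all

lemma clock_mono: "0 \<le> s \<Longrightarrow> s \<le> t \<Longrightarrow> clock a s \<le> clock a t"
  using le_clock_iff[of t "clock a s"] clock_le[of s] by simp

lemma clock_at_top: "filterlim (clock a) sequentially at_top"
  unfolding filterlim_at_top
proof
  fix N
  show "\<forall>\<^sub>F t in at_top. N \<le> clock a t"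
    using eventually_ge_at_top[of "tau a N"]
    by eventually_elim (use le_clock_iff order_trans[OF tau_nonneg] in blast)
qed

lemma norm_sum_steps_le:
  assumes "n \<le> k" "\<And>j. n \<le> j \<Longrightarrow> j < k \<Longrightarrow> norm (v j) \<le> M"
  shows "norm (\<Sum>j=n..<k. a (Suc j) *\<^sub>R v j) \<le> M * (tau a k - tau a n)"
proof -
  have "norm (\<Sum>j=n..<k. a (Suc j) *\<^sub>R v j) \<le> (\<Sum>j=n..<k. a (Suc j) * M)"
    by (rule sum_norm_le) (use assms(2) less_imp_le[OF Suc_pos] in \<open>auto intro!: mult_mono\<close>)
  then show ?thesis by (simp add: tau_diff[OF assms(1)] sum_distrib_left mult.commute)
qed

text \<open>A window has total weight at most \<open>T\<close>, so terms below
  \<open>\<epsilon> / T\<close> add up to at most \<open>\<epsilon>\<close>.\<close>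

lemma negligible_noise_if_tendsto_0:
  assumes "e \<longlonglongrightarrow> 0"
  shows "negligible_noise a e"
  unfolding negligible_noise_def
proof (intro allI impI)
  fix T \<epsilon> :: real assume "T > 0" "\<epsilon> > 0"
  then have "\<epsilon> / T > 0" by simp
  from tendstoD[OF assms this] obtain N where N: "\<And>j. j \<ge> N \<Longrightarrow> norm (e j) < \<epsilon> / T"
    by (auto simp: eventually_sequentially)
  have "norm (\<Sum>j=n..<k. a (Suc j) *\<^sub>R e j) \<le> \<epsilon>"
    if "n \<ge> N" "k \<ge> n" "tau a k - tau a n \<le> T" for n k
  proof -
    have "norm (\<Sum>j=n..<k. a (Suc j) *\<^sub>R e j) \<le> \<epsilon> / T * (tau a k - tau a n)"
      using N that(1) by (intro norm_sum_steps_le[OF that(2)]) (simp add: less_imp_le)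
    also have "\<dots> \<le> \<epsilon> / T * T" using that(3) \<open>\<epsilon> / T > 0\<close> by (intro mult_left_mono) auto
    finally show ?thesis using \<open>T > 0\<close> by simp
  qed
  then show "\<forall>\<^sub>F n in sequentially. \<forall>k\<ge>n. tau a k - tau a n \<le> T \<longrightarrow>
      norm (\<Sum>j=n..<k. a (Suc j) *\<^sub>R e j) \<le> \<epsilon>"
    unfolding eventually_sequentially by blast
qed

lemma negligible_noise_if_noise_vanishes:
  assumes "noise_vanishes a u"
  shows "negligible_noise a (\<lambda>n. u (Suc n))"
  unfolding negligible_noise_def
proof (intro allI impI)
  fix T \<epsilon> :: real assume "T > 0" "\<epsilon> > 0"
  let ?g = "\<lambda>n k. norm (\<Sum>j=n..<k. a (j + 1) *\<^sub>R u (j + 1))"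
  have "(\<lambda>n. SUP k\<in>{n + 1..clock a (tau a n + T)}. ?g n k) \<longlonglongrightarrow> 0"
    using assms \<open>T > 0\<close> unfolding noise_vanishes_def by blast
  then have "\<forall>\<^sub>F n in sequentially. (SUP k\<in>{n + 1..clock a (tau a n + T)}. ?g n k) < \<epsilon>"
    using \<open>\<epsilon> > 0\<close> by (rule order_tendstoD(2))
  then show "\<forall>\<^sub>F n in sequentially. \<forall>k\<ge>n. tau a k - tau a n \<le> T \<longrightarrow>
      norm (\<Sum>j=n..<k. a (Suc j) *\<^sub>R u (Suc j)) \<le> \<epsilon>"
  proof eventually_elim
    case (elim n)
    have "norm (\<Sum>j=n..<k. a (Suc j) *\<^sub>R u (Suc j)) \<le> \<epsilon>"
      if "k \<ge> n" "tau a k - tau a n \<le> T" for k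
    proof (cases "k = n")
      \<comment> \<open>The supremum ranges over \<open>k\<close> from \<open>n + 1\<close> on; for
        \<open>k = n\<close> the sum is empty.\<close>
      case False
      have "tau a n + T \<ge> 0" using \<open>T > 0\<close> by (simp add: add_nonneg_nonneg)
      then have "k \<in> {n + 1..clock a (tau a n + T)}"
        using that False le_clock_iff[of "tau a n + T" k] by simp
      then have "?g n k \<le> (SUP k\<in>{n + 1..clock a (tau a n + T)}. ?g n k)"
        by (intro cSUP_upper) auto
      then show ?thesis using elim by simp
    qed (use \<open>\<epsilon> > 0\<close> in simp)
    then show ?case by blast
  qed
qed

end

locale perturbed_iteration = step_sizes a for a +
  fixes S :: "'a::banach set" and f :: "'a \<Rightarrow> 'a" and u e :: "nat \<Rightarrow> 'a"
  assumes compact: "compact S" and cont: "continuous_on S f"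
    and uniq: "unique_solutions_in S f"
    and inS: "\<And>n. u n \<in> S"
    and step: "\<And>n. u (Suc n) = u n + a (Suc n) *\<^sub>R (f (u n) + e n)"
    and noise: "negligible_noise a e"
begin

text \<open>On a short window the drift is nearly frozen: the iterates move by at most
  \<open>\<delta> / 2\<close> through the drift and \<open>\<delta> / 4\<close> through the noise,
  hence stay where \<open>f\<close> differs from \<open>f (u n)\<close> by less than
  \<open>\<epsilon>\<close>. The noise sum itself becomes the additive error.\<close>

lemma increments:
  assumes "\<epsilon> > 0"
  obtains \<eta> where "\<eta> > 0" "\<And>\<zeta>. \<zeta> > 0 \<Longrightarrow> \<forall>\<^sub>F n in sequentially. \<forall>k\<ge>n. tau a k - tau a n \<le> \<eta> \<longrightarrow>
    norm (u k - u n - (tau a k - tau a n) *\<^sub>R f (u n)) \<le> \<epsilon> * (tau a k - tau a n) + \<zeta>"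
proof -
  obtain M where M: "M > 0" "\<And>v. v \<in> S \<Longrightarrow> norm (f v) \<le> M"
    using continuous_on_compact_norm_bound[OF compact cont] by blast
  obtain \<delta> where \<delta>: "\<delta> > 0" "\<And>v w. v \<in> S \<Longrightarrow> w \<in> S \<Longrightarrow> dist v w < \<delta> \<Longrightarrow> dist (f v) (f w) < \<epsilon>"
    using compact_uniformly_continuous[OF cont compact] \<open>\<epsilon> > 0\<close>
    unfolding uniformly_continuous_on_def by metis
  \<comment> \<open>The cap \<open>1\<close> places the window inside the unit window on which the
    noise will be controlled.\<close>
  define \<eta> where "\<eta> = min 1 (\<delta> / (2 * M))"
  have "M * \<eta> \<le> M * (\<delta> / (2 * M))" using M(1) unfolding \<eta>_def by (intro mult_left_mono) auto
  also have "\<dots> = \<delta> / 2" using M(1) by simp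
  finally have \<eta>: "\<eta> > 0" "\<eta> \<le> 1" "M * \<eta> \<le> \<delta> / 2"
    using M(1) \<delta>(1) by (auto simp: \<eta>_def)
  have "\<forall>\<^sub>F n in sequentially. \<forall>k\<ge>n. tau a k - tau a n \<le> \<eta> \<longrightarrow>
    norm (u k - u n - (tau a k - tau a n) *\<^sub>R f (u n)) \<le> \<epsilon> * (tau a k - tau a n) + \<zeta>"
    if "\<zeta> > 0" for \<zeta>
  proof -
    \<comment> \<open>The noise bound has two tasks: \<open>\<zeta>\<close> for the final error and
      \<open>\<delta> / 4\<close> for keeping the iterates near \<open>u n\<close>.\<close>
    have "min \<zeta> (\<delta> / 4) > 0" using \<open>\<zeta> > 0\<close> \<delta>(1) by simp
    from negligible_noiseD[OF noise zero_less_one this] show ?thesis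
    proof eventually_elim
      case (elim n)
      have noise_le: "norm (\<Sum>j=n..<k. a (Suc j) *\<^sub>R e j) \<le> min \<zeta> (\<delta> / 4)"
        if "k \<ge> n" "tau a k - tau a n \<le> \<eta>" for k
        using elim[rule_format, OF that(1)] that(2) \<eta>(2) by linarith
      have diff: "u k - u n = (\<Sum>j=n..<k. a (Suc j) *\<^sub>R f (u j)) + (\<Sum>j=n..<k. a (Suc j) *\<^sub>R e j)"
        if "k \<ge> n" for k
        using recursion_diff[of u a "\<lambda>n. f (u n) + e n", OF step that]
        by (simp add: scaleR_add_right sum.distrib)
      have "norm (u k - u n - (tau a k - tau a n) *\<^sub>R f (u n)) \<le> \<epsilon> * (tau a k - tau a n) + \<zeta>"
        if k: "k \<ge> n" "tau a k - tau a n \<le> \<eta>" for k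
      proof -
        have near: "norm (f (u j) - f (u n)) \<le> \<epsilon>" if j: "n \<le> j" "j < k" for j
        proof -
          have "tau a j - tau a n \<le> \<eta>" using tau_mono[of j k] j k(2) by simp
          then have "norm (\<Sum>i=n..<j. a (Suc i) *\<^sub>R e i) \<le> \<delta> / 4"
            using noise_le[OF j(1)] by simp
          moreover have "norm (\<Sum>i=n..<j. a (Suc i) *\<^sub>R f (u i)) \<le> M * (tau a j - tau a n)"
            by (rule norm_sum_steps_le[OF j(1)]) (rule M(2)[OF inS])
          moreover have "M * (tau a j - tau a n) \<le> M * \<eta>"
            using M(1) \<open>tau a j - tau a n \<le> \<eta>\<close> by simp
          ultimately have "norm (u j - u n) \<le> 3 / 4 * \<delta>"
            unfolding diff[OF j(1)] using \<eta>(3) by (intro norm_triangle_le) linarith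
          then have "dist (u j) (u n) < \<delta>" using \<delta>(1) by (simp add: dist_norm)
          then show ?thesis using \<delta>(2)[OF inS inS] by (simp add: dist_norm less_imp_le)
        qed
        have "u k - u n - (tau a k - tau a n) *\<^sub>R f (u n) =
            (\<Sum>j=n..<k. a (Suc j) *\<^sub>R (f (u j) - f (u n))) + (\<Sum>j=n..<k. a (Suc j) *\<^sub>R e j)"
          unfolding diff[OF k(1)] tau_diff[OF k(1)]
          by (simp add: scaleR_diff_right sum_subtractf scaleR_sum_left)
        moreover have "norm (\<Sum>j=n..<k. a (Suc j) *\<^sub>R (f (u j) - f (u n))) \<le> \<epsilon> * (tau a k - tau a n)"
          by (rule norm_sum_steps_le[OF k(1) near])
        ultimately show ?thesis using noise_le[OF k] by (auto intro!: norm_triangle_le)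
      qed
      then show ?case by blast
    qed
  qed
  then show ?thesis using that \<eta>(1) by blast
qed

text \<open>The clock rounds both times down to grid times, each by less than one step, so the
  elapsed time changes by at most \<open>\<rho>\<close> once the steps are shorter than
  \<open>\<rho>\<close>. The cost of the rounding goes into the additive error.\<close>

lemma approximate_solutions_shifts:
  "approximate_solutions S f (\<lambda>n t. u (clock a (tau a n + t)))"
  unfolding approximate_solutions_def
proof (intro conjI allI impI)
  fix \<epsilon> :: real assume "\<epsilon> > 0"
  obtain M where M: "M > 0" "\<And>v. v \<in> S \<Longrightarrow> norm (f v) \<le> M"
    using continuous_on_compact_norm_bound[OF compact cont] by blast
  obtain \<eta> where \<eta>: "\<eta> > 0" "\<And>\<zeta>. \<zeta> > 0 \<Longrightarrow> \<forall>\<^sub>F n in sequentially. \<forall>k\<ge>n. tau a k - tau a n \<le> \<eta> \<longrightarrow>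
      norm (u k - u n - (tau a k - tau a n) *\<^sub>R f (u n)) \<le> \<epsilon> * (tau a k - tau a n) + \<zeta>"
    using increments[OF \<open>\<epsilon> > 0\<close>] by blast
  show "\<exists>\<eta>>0. \<forall>\<zeta>>0. \<forall>\<^sub>F n in sequentially. \<forall>s\<ge>0. \<forall>t\<ge>s. t - s \<le> \<eta> \<longrightarrow>
      norm (u (clock a (tau a n + t)) - u (clock a (tau a n + s))
        - (t - s) *\<^sub>R f (u (clock a (tau a n + s)))) \<le> \<epsilon> * (t - s) + \<zeta>"
  \<comment> \<open>The threshold is halved since rounding can lengthen the window by up to
    \<open>\<rho>\<close>, which is at most \<open>\<eta> / 2\<close>.\<close>
  proof (intro exI[of _ "\<eta> / 2"] conjI allI impI)
    show "\<eta> / 2 > 0" using \<eta>(1) by simp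
    fix \<zeta> :: real assume "\<zeta> > 0"
    \<comment> \<open>A change of \<open>\<rho>\<close> in elapsed time costs
      \<open>\<epsilon> * \<rho>\<close> in the linear error and \<open>M * \<rho>\<close> in the
      drift; together they may use half of \<open>\<zeta>\<close>.\<close>
    define \<rho> where "\<rho> = min (\<eta> / 2) (\<zeta> / (2 * (\<epsilon> + M)))"
    have "\<rho> > 0" "\<rho> \<le> \<eta> / 2"
      using \<eta>(1) \<open>\<zeta> > 0\<close> \<open>\<epsilon> > 0\<close> M(1) unfolding \<rho>_def by (simp_all only: min.cobounded1, simp)
    have "(\<epsilon> + M) * \<rho> \<le> (\<epsilon> + M) * (\<zeta> / (2 * (\<epsilon> + M)))"
      using M(1) \<open>\<epsilon> > 0\<close> unfolding \<rho>_def by (intro mult_left_mono) auto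
    also have "\<dots> = \<zeta> / 2" using M(1) \<open>\<epsilon> > 0\<close> by (simp add: field_simps)
    finally have \<rho>: "(\<epsilon> + M) * \<rho> \<le> \<zeta> / 2" .
    obtain N1 where N1: "\<And>n. n \<ge> N1 \<Longrightarrow> a n < \<rho>"
      using order_tendstoD(2)[OF tendsto_0 \<open>\<rho> > 0\<close>] unfolding eventually_sequentially by blast
    have "\<zeta> / 2 > 0" using \<open>\<zeta> > 0\<close> by simp
    from \<eta>(2)[OF this] obtain N2 where N2: "\<And>n k. n \<ge> N2 \<Longrightarrow> k \<ge> n \<Longrightarrow> tau a k - tau a n \<le> \<eta> \<Longrightarrow>
        norm (u k - u n - (tau a k - tau a n) *\<^sub>R f (u n)) \<le> \<epsilon> * (tau a k - tau a n) + \<zeta> / 2"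
      unfolding eventually_sequentially by blast
    have "norm (u (clock a (tau a n + t)) - u (clock a (tau a n + s))
        - (t - s) *\<^sub>R f (u (clock a (tau a n + s)))) \<le> \<epsilon> * (t - s) + \<zeta>"
      if n: "n \<ge> max N1 N2" and st: "0 \<le> s" "s \<le> t" "t - s \<le> \<eta> / 2" for n s t
    proof -
      define m where "m = clock a (tau a n + s)"
      define k where "k = clock a (tau a n + t)"
      have nonneg: "tau a n + s \<ge> 0" "tau a n + t \<ge> 0" using st by auto
      have "m \<ge> n" unfolding m_def le_clock_iff[OF nonneg(1)] using st by simp
      have "m \<le> k" unfolding m_def k_def using st nonneg by (intro clock_mono) auto
      have "a (Suc m) < \<rho>" "a (Suc k) < \<rho>" using N1 n \<open>m \<ge> n\<close> \<open>m \<le> k\<close> by auto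
      then have "\<bar>(tau a k - tau a m) - (t - s)\<bar> \<le> \<rho>"
        using clock_le[OF nonneg(1)] clock_gt[OF nonneg(1)] clock_le[OF nonneg(2)] clock_gt[OF nonneg(2)]
        unfolding m_def[symmetric] k_def[symmetric] by linarith
      then have tau: "tau a k - tau a m \<le> t - s + \<rho>" "\<bar>(tau a k - tau a m) - (t - s)\<bar> \<le> \<rho>" by auto
      have "norm (u k - u m - (tau a k - tau a m) *\<^sub>R f (u m)) \<le> \<epsilon> * (tau a k - tau a m) + \<zeta> / 2"
        using tau(1) st(3) \<open>\<rho> \<le> \<eta> / 2\<close> n \<open>m \<ge> n\<close> \<open>m \<le> k\<close> by (intro N2) auto
      also have "\<dots> \<le> \<epsilon> * (t - s + \<rho>) + \<zeta> / 2" using tau(1) \<open>\<epsilon> > 0\<close> by simp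
      finally have 1: "norm (u k - u m - (tau a k - tau a m) *\<^sub>R f (u m)) \<le> \<epsilon> * (t - s + \<rho>) + \<zeta> / 2" .
      have 2: "norm (((tau a k - tau a m) - (t - s)) *\<^sub>R f (u m)) \<le> \<rho> * M"
        unfolding norm_scaleR using tau(2) M(2)[OF inS] \<open>\<rho> > 0\<close> by (intro mult_mono) auto
      have "u k - u m - (t - s) *\<^sub>R f (u m) = (u k - u m - (tau a k - tau a m) *\<^sub>R f (u m))
          + ((tau a k - tau a m) - (t - s)) *\<^sub>R f (u m)"
        by (simp add: algebra_simps)
      also have "norm \<dots> \<le> \<epsilon> * (t - s + \<rho>) + \<zeta> / 2 + \<rho> * M"
        by (rule norm_triangle_le[OF add_mono[OF 1 2]])
      also have "\<dots> = \<epsilon> * (t - s) + \<zeta> / 2 + (\<epsilon> + M) * \<rho>" by (simp add: algebra_simps)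
      also have "\<dots> \<le> \<epsilon> * (t - s) + \<zeta>" using \<rho> by simp
      finally show ?thesis unfolding m_def k_def .
    qed
    then show "\<forall>\<^sub>F n in sequentially. \<forall>s\<ge>0. \<forall>t\<ge>s. t - s \<le> \<eta> / 2 \<longrightarrow>
        norm (u (clock a (tau a n + t)) - u (clock a (tau a n + s))
          - (t - s) *\<^sub>R f (u (clock a (tau a n + s)))) \<le> \<epsilon> * (t - s) + \<zeta>"
      unfolding eventually_sequentially by blast
  qed
qed (rule inS)

text \<open>Starting points and elapsed times of a sequence of violations lie in the compact set
  \<open>S \<times> {0..T}\<close>. Along a convergent subsequence the iterates and the flow have
  the same limit, which contradicts their distance of at least \<open>\<epsilon>\<close>.\<close>

lemma tracks_flow:
  assumes "\<epsilon> > 0"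
  shows "\<forall>\<^sub>F n in sequentially. \<forall>k\<ge>n. tau a k - tau a n \<le> T \<longrightarrow>
    dist (u k) (ode_flow S f (tau a k - tau a n) (u n)) < \<epsilon>"
proof (rule ccontr)
  assume "\<not> ?thesis"
  then have "\<exists>\<^sub>F n in sequentially. \<exists>k\<ge>n. tau a k - tau a n \<le> T \<and>
      \<not> dist (u k) (ode_flow S f (tau a k - tau a n) (u n)) < \<epsilon>"
    unfolding not_eventually by simp
  then obtain q where q: "strict_mono (q::nat \<Rightarrow> nat)" and "\<And>i. \<exists>k\<ge>q i. tau a k - tau a (q i) \<le> T \<and>
      \<not> dist (u k) (ode_flow S f (tau a k - tau a (q i)) (u (q i))) < \<epsilon>"
    using frequently_sequentially_subseq by blast
  then obtain k where k: "\<And>i. k i \<ge> q i" "\<And>i. tau a (k i) - tau a (q i) \<le> T"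
      "\<And>i. \<not> dist (u (k i)) (ode_flow S f (tau a (k i) - tau a (q i)) (u (q i))) < \<epsilon>"
    by metis
  define \<sigma> where "\<sigma> i = tau a (k i) - tau a (q i)" for i
  have \<sigma>: "\<sigma> i \<ge> 0" "\<sigma> i \<le> T" for i using tau_mono[OF k(1)] k(2) by (auto simp: \<sigma>_def)
  have "seq_compact (S \<times> {0..T})"
    using compact_Times[OF compact compact_Icc] by (simp add: compact_eq_seq_compact_metric)
  moreover have "\<forall>i. (u (q i), \<sigma> i) \<in> S \<times> {0..T}" using inS \<sigma> by simp
  ultimately obtain l r where r: "strict_mono (r::nat \<Rightarrow> nat)" and "((\<lambda>i. (u (q i), \<sigma> i)) \<circ> r) \<longlonglongrightarrow> l"
    by (rule seq_compactE)
  from tendsto_fst[OF this(2)] tendsto_snd[OF this(2)]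
  have lim: "(\<lambda>i. u (q (r i))) \<longlonglongrightarrow> fst l" "(\<lambda>i. \<sigma> (r i)) \<longlonglongrightarrow> snd l"
    by (simp_all add: o_def)
  \<comment> \<open>No rounding occurs here: \<open>tau a (q (r i)) + \<sigma> (r i)\<close> is the
    grid time \<open>tau a (k (r i))\<close>, at which the clock reads
    \<open>k (r i)\<close>.\<close>
  have "(\<lambda>i. u (clock a (tau a (q (r i)) + \<sigma> (r i)))) \<longlonglongrightarrow> ode_flow S f (snd l) (fst l)"
    using approximate_solutions_tendsto[OF compact cont uniq
        approximate_solutions_reindex[OF approximate_solutions_shifts
          filterlim_subseq[OF strict_mono_o[OF q r]]], of "fst l", OF _ lim(2) \<sigma>(1)] lim(1)
    by (simp add: o_def)
  moreover have "(\<lambda>i. ode_flow S f (\<sigma> (r i)) (u (q (r i)))) \<longlonglongrightarrow> ode_flow S f (snd l) (fst l)"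
    by (rule ode_flow_tendsto[OF compact cont uniq lim(1) inS lim(2) \<sigma>(1)])
  ultimately have "(\<lambda>i. dist (u (k (r i))) (ode_flow S f (\<sigma> (r i)) (u (q (r i)))))
      \<longlonglongrightarrow> dist (ode_flow S f (snd l) (fst l)) (ode_flow S f (snd l) (fst l))"
    by (intro tendsto_dist) (simp_all add: \<sigma>_def)
  then have "\<epsilon> \<le> dist (ode_flow S f (snd l) (fst l)) (ode_flow S f (snd l) (fst l))"
    by (rule LIMSEQ_le_const) (use k(3) in \<open>auto simp: \<sigma>_def not_less\<close>)
  then show False using \<open>\<epsilon> > 0\<close> by simp
qed

end

section \<open>Two time scales\<close>

lemma ode_solution_frozen:
  assumes "\<xi> \<in> C" "ode_solution D (\<lambda>v. G (\<xi>, v)) v \<phi>"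
  shows "ode_solution (C \<times> D) (\<lambda>p. (0, G p)) (\<xi>, v) (\<lambda>t. (\<xi>, \<phi> t))"
  using assms unfolding ode_solution_def by (auto intro!: has_vector_derivative_Pair)

lemma ode_solution_frozenD:
  fixes G :: "'a::real_normed_vector \<times> 'b::real_normed_vector \<Rightarrow> 'b"
  assumes "ode_solution (C \<times> D) (\<lambda>p. (0, G p)) (\<xi>, v) \<psi>"
  shows "\<And>t. t \<ge> 0 \<Longrightarrow> fst (\<psi> t) = \<xi>" "ode_solution D (\<lambda>v. G (\<xi>, v)) v (\<lambda>t. snd (\<psi> t))"
proof -
  have \<psi>: "\<psi> 0 = (\<xi>, v)" "\<And>t. t \<ge> 0 \<Longrightarrow> \<psi> t \<in> C \<times> D"
      "\<And>t. t \<ge> 0 \<Longrightarrow> (\<psi> has_vector_derivative (0, G (\<psi> t))) (at t within {0..})"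
    using assms unfolding ode_solution_def by auto
  have "((\<lambda>t. fst (\<psi> t)) has_vector_derivative 0) (at t within {0..})" if "t \<in> {0..}" for t
    using bounded_linear.has_vector_derivative[OF bounded_linear_fst \<psi>(3)] that by simp
  from has_vector_derivative_zero_constant[OF convex_real_interval(1) this]
  obtain c where "\<And>t. t \<in> {0..} \<Longrightarrow> fst (\<psi> t) = c" by blast
  then show fst: "fst (\<psi> t) = \<xi>" if "t \<ge> 0" for t
    using that \<psi>(1) by (metis atLeast_iff fst_conv order_refl)
  have "((\<lambda>t. snd (\<psi> t)) has_vector_derivative G (\<xi>, snd (\<psi> t))) (at t within {0..})"
    if "t \<ge> 0" for t
    using bounded_linear.has_vector_derivative[OF bounded_linear_snd \<psi>(3)[OF that]] fst[OF that]
    by (metis prod.collapse snd_conv)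
  then show "ode_solution D (\<lambda>v. G (\<xi>, v)) v (\<lambda>t. snd (\<psi> t))"
    using \<psi>(1,2) unfolding ode_solution_def by (auto simp: mem_Times_iff)
qed

text \<open>Making the parameter \<open>\<xi>\<close> part of the state turns dependence on a
  parameter into dependence on the initial value, which continuity of the flow already
  covers.\<close>

lemma frozen_system:
  fixes G :: "'a::real_normed_vector \<times> 'b::real_normed_vector \<Rightarrow> 'b"
  assumes uniq: "\<And>\<xi>. \<xi> \<in> C \<Longrightarrow> unique_solutions_in D (\<lambda>v. G (\<xi>, v))"
  shows unique_solutions_in_frozen: "unique_solutions_in (C \<times> D) (\<lambda>p. (0, G p))"
    and ode_flow_frozen: "\<And>\<xi> v t. \<xi> \<in> C \<Longrightarrow> v \<in> D \<Longrightarrow> t \<ge> 0 \<Longrightarrow>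
      ode_flow (C \<times> D) (\<lambda>p. (0, G p)) t (\<xi>, v) = (\<xi>, ode_flow D (\<lambda>v. G (\<xi>, v)) t v)"
proof -
  have sol: "ode_solution (C \<times> D) (\<lambda>p. (0, G p)) (\<xi>, v) (\<lambda>t. (\<xi>, ode_flow D (\<lambda>v. G (\<xi>, v)) t v))"
    if "\<xi> \<in> C" "v \<in> D" for \<xi> v
    by (rule ode_solution_frozen[OF that(1) ode_flow_solution[OF uniq[OF that(1)] that(2)]])
  have eq: "\<psi> t = (\<xi>, ode_flow D (\<lambda>v. G (\<xi>, v)) t v)"
    if "\<xi> \<in> C" "v \<in> D" "ode_solution (C \<times> D) (\<lambda>p. (0, G p)) (\<xi>, v) \<psi>" "t \<ge> 0" for \<xi> v \<psi> t
    using ode_solution_frozenD(1)[OF that(3,4)]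
      ode_flow_eqI[OF uniq[OF that(1)] that(2) ode_solution_frozenD(2)[OF that(3)] that(4)]
    by (simp add: prod_eq_iff)
  show *: "unique_solutions_in (C \<times> D) (\<lambda>p. (0, G p))"
    unfolding unique_solutions_in_def
  proof
    fix p assume "p \<in> C \<times> D"
    then obtain \<xi> v where p: "p = (\<xi>, v)" "\<xi> \<in> C" "v \<in> D" by blast
    show "\<exists>\<phi>. ode_solution (C \<times> D) (\<lambda>p. (0, G p)) p \<phi> \<and>
        (\<forall>\<psi>. ode_solution (C \<times> D) (\<lambda>p. (0, G p)) p \<psi> \<longrightarrow> (\<forall>t\<ge>0. \<psi> t = \<phi> t))"
      unfolding p(1) using sol[OF p(2,3)] eq[OF p(2,3)] by blast
  qed
  show "ode_flow (C \<times> D) (\<lambda>p. (0, G p)) t (\<xi>, v) = (\<xi>, ode_flow D (\<lambda>v. G (\<xi>, v)) t v)"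
    if "\<xi> \<in> C" "v \<in> D" "t \<ge> 0" for \<xi> v t
    using ode_flow_eqI[OF * _ sol[OF that(1,2)] that(3)] that by simp
qed

lemma negligible_noise_Pair:
  assumes "negligible_noise a e" "negligible_noise a e'"
  shows "negligible_noise a (\<lambda>n. (e n, e' n))"
proof -
  \<comment> \<open>The coordinate embeddings are linear isometries, so they commute with weighted
    sums and preserve their norms; a pair is the sum of its two embedded coordinates.\<close>
  have embed: "negligible_noise a (\<lambda>n. h (e n))"
    if "negligible_noise a e" "linear h" "\<And>v. norm (h v) = norm v"
    for h :: "'x::real_normed_vector \<Rightarrow> 'y::real_normed_vector" and e
    using that(1,3) unfolding negligible_noise_def
    by (simp add: linear_cmul[OF that(2), symmetric] linear_sum[OF that(2), symmetric])
  have "negligible_noise a (\<lambda>n. (e n, 0))" "negligible_noise a (\<lambda>n. (0, e' n))"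
    by (rule embed[OF assms(1)], auto intro!: linearI) (rule embed[OF assms(2)], auto intro!: linearI)
  from negligible_noise_add[OF this] show ?thesis by simp
qed

text \<open>The weights cancel, so the fast sum equals the slow sum over the same indices. Once the
  ratio is below \<open>1 / T\<close>, a fast window of length \<open>T\<close> has slow length at
  most 1.\<close>

lemma negligible_noise_rescale:
  assumes "step_sizes \<alpha>" "step_sizes \<gamma>" and ratio: "(\<lambda>n. \<alpha> n / \<gamma> n) \<longlonglongrightarrow> 0"
    and e: "negligible_noise \<alpha> e"
  shows "negligible_noise \<gamma> (\<lambda>n. (\<alpha> (Suc n) / \<gamma> (Suc n)) *\<^sub>R e n)"
  unfolding negligible_noise_def
proof (intro allI impI)
  interpret slow: step_sizes \<alpha> by fact
  interpret fast: step_sizes \<gamma> by fact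
  fix T \<epsilon> :: real assume "T > 0" "\<epsilon> > 0"
  have "1 / T > 0" using \<open>T > 0\<close> by simp
  from order_tendstoD(2)[OF ratio this] obtain N where N: "\<And>n. n \<ge> N \<Longrightarrow> \<alpha> n / \<gamma> n < 1 / T"
    unfolding eventually_sequentially by blast
  have "\<forall>\<^sub>F n in sequentially. n \<ge> N" by (rule eventually_ge_at_top)
  with negligible_noiseD[OF e zero_less_one \<open>\<epsilon> > 0\<close>]
  show "\<forall>\<^sub>F n in sequentially. \<forall>k\<ge>n. tau \<gamma> k - tau \<gamma> n \<le> T \<longrightarrow>
      norm (\<Sum>j=n..<k. \<gamma> (Suc j) *\<^sub>R (\<alpha> (Suc j) / \<gamma> (Suc j)) *\<^sub>R e j) \<le> \<epsilon>"
  proof eventually_elim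
    case (elim n)
    have "norm (\<Sum>j=n..<k. \<gamma> (Suc j) *\<^sub>R (\<alpha> (Suc j) / \<gamma> (Suc j)) *\<^sub>R e j) \<le> \<epsilon>"
      if k: "k \<ge> n" "tau \<gamma> k - tau \<gamma> n \<le> T" for k
    proof -
      have "\<alpha> (Suc j) \<le> \<gamma> (Suc j) / T" if "j \<ge> n" for j
        using N[of "Suc j"] that elim(2) fast.Suc_pos[of j] \<open>T > 0\<close> by (simp add: field_simps)
      then have "(\<Sum>j=n..<k. \<alpha> (Suc j)) \<le> (\<Sum>j=n..<k. \<gamma> (Suc j) / T)" by (intro sum_mono) auto
      then have "tau \<alpha> k - tau \<alpha> n \<le> (tau \<gamma> k - tau \<gamma> n) / T"
        by (simp add: tau_diff[OF k(1)] sum_divide_distrib)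
      also have "\<dots> \<le> 1" using k(2) \<open>T > 0\<close> by simp
      finally have "norm (\<Sum>j=n..<k. \<alpha> (Suc j) *\<^sub>R e j) \<le> \<epsilon>"
        using elim(1) k(1) by blast
      moreover have "\<gamma> (Suc j) \<noteq> 0" for j by (rule less_imp_neq[OF fast.Suc_pos, symmetric])
      ultimately show ?thesis by simp
    qed
    then show ?case by blast
  qed
qed

text \<open>This describes a single sample path; \<open>e n\<close> and \<open>g n\<close> will each
  stand for the noise plus the bias of the step from \<open>n\<close> to
  \<open>Suc n\<close>.\<close>

locale two_timescale = slow: step_sizes \<alpha> + fast: step_sizes \<gamma> for \<alpha> \<gamma> +
  fixes F :: "'a::banach \<times> 'b::banach \<Rightarrow> 'a" and G :: "'a \<times> 'b \<Rightarrow> 'b"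
    and C :: "'a set" and D :: "'b set" and ystar :: "'a \<Rightarrow> 'b"
    and x e :: "nat \<Rightarrow> 'a" and y g :: "nat \<Rightarrow> 'b"
  assumes ratio: "(\<lambda>n. \<alpha> n / \<gamma> n) \<longlonglongrightarrow> 0"
    and compact_C: "compact C" and compact_D: "compact D"
    and xC: "\<And>n. x n \<in> C" and yD: "\<And>n. y n \<in> D"
    and cont_F: "continuous_on (C \<times> D) F" and cont_G: "continuous_on (C \<times> D) G"
    and x_step: "\<And>n. x (Suc n) = x n + \<alpha> (Suc n) *\<^sub>R (F (x n, y n) + e n)"
    and y_step: "\<And>n. y (Suc n) = y n + \<gamma> (Suc n) *\<^sub>R (G (x n, y n) + g n)"
    and slow_noise: "negligible_noise \<alpha> e" and fast_noise: "negligible_noise \<gamma> g"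
    and fast_uniq: "\<And>\<xi>. \<xi> \<in> C \<Longrightarrow> unique_solutions_in D (\<lambda>v. G (\<xi>, v))"
    and fast_attr: "\<And>\<xi>. \<xi> \<in> C \<Longrightarrow> globally_attracting_fixed_point D (\<lambda>v. G (\<xi>, v)) (ystar \<xi>)"
    and cont_ystar: "continuous_on C ystar"
    and slow_uniq: "unique_solutions_in C (\<lambda>u. F (u, ystar u))"
begin

lemma compact_CD: "compact (C \<times> D)"
  by (intro compact_Times compact_C compact_D)

lemma ystar_in: "\<xi> \<in> C \<Longrightarrow> ystar \<xi> \<in> D"
  using fast_attr unfolding globally_attracting_fixed_point_def by blast

text \<open>On the fast time scale the slow component is a constant, up to negligible noise.\<close>
sublocale fast: perturbed_iteration \<gamma> "C \<times> D" "\<lambda>p. (0, G p)" "\<lambda>n. (x n, y n)"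
  "\<lambda>n. ((\<alpha> (Suc n) / \<gamma> (Suc n)) *\<^sub>R (F (x n, y n) + e n), g n)"
proof
  show "compact (C \<times> D)" by (rule compact_CD)
  show "continuous_on (C \<times> D) (\<lambda>p. (0, G p))" by (intro continuous_intros cont_G)
  show "unique_solutions_in (C \<times> D) (\<lambda>p. (0, G p))" by (rule unique_solutions_in_frozen[OF fast_uniq])
  show "(x n, y n) \<in> C \<times> D" for n using xC yD by simp
  have "\<gamma> (Suc n) \<noteq> 0" for n by (rule less_imp_neq[OF fast.Suc_pos, symmetric])
  then show "(x (Suc n), y (Suc n)) = (x n, y n) + \<gamma> (Suc n) *\<^sub>R
      ((0, G (x n, y n)) + ((\<alpha> (Suc n) / \<gamma> (Suc n)) *\<^sub>R (F (x n, y n) + e n), g n))" for n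
    by (simp add: x_step y_step)
  obtain M where M: "\<And>p. p \<in> C \<times> D \<Longrightarrow> norm (F p) \<le> M"
    using continuous_on_compact_norm_bound[OF compact_CD cont_F] by blast
  \<comment> \<open>The rescaled drift tends to 0 term by term because \<open>F\<close> is bounded
    on \<open>C \<times> D\<close>. No such bound is available for \<open>e\<close>, whose rescaled
    sums are compared window by window instead.\<close>
  have "(\<lambda>n. (\<alpha> (Suc n) / \<gamma> (Suc n)) *\<^sub>R F (x n, y n)) \<longlonglongrightarrow> 0"
  proof (rule Lim_null_comparison)
    show "(\<lambda>n. \<bar>\<alpha> (Suc n) / \<gamma> (Suc n)\<bar> * M) \<longlonglongrightarrow> 0"
      using tendsto_mult_left_zero[OF tendsto_rabs_zero[OF LIMSEQ_Suc[OF ratio]]] .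
    show "\<forall>\<^sub>F n in sequentially. norm ((\<alpha> (Suc n) / \<gamma> (Suc n)) *\<^sub>R F (x n, y n))
        \<le> \<bar>\<alpha> (Suc n) / \<gamma> (Suc n)\<bar> * M"
      using M xC yD by (intro always_eventually allI) (simp add: mult_left_mono del: abs_divide)
  qed
  from negligible_noise_add[OF fast.negligible_noise_if_tendsto_0[OF this]
      negligible_noise_rescale[OF slow.step_sizes_axioms fast.step_sizes_axioms ratio slow_noise]]
  show "negligible_noise \<gamma> (\<lambda>n. ((\<alpha> (Suc n) / \<gamma> (Suc n)) *\<^sub>R (F (x n, y n) + e n), g n))"
    by (intro negligible_noise_Pair fast_noise) (simp add: scaleR_add_right)
qed

text \<open>At time \<open>tau \<gamma> n\<close>, compare \<open>y n\<close> with the trajectory started at the iterate a time \<open>T\<close>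
  earlier. In the limit of a convergent subsequence, the frozen slow variable \<open>\<xi>\<close> is the same at
  both times, so uniform attraction within the fibre over \<open>\<xi>\<close> suffices.\<close>
lemma dist_y_ystar_tendsto_0: "(\<lambda>n. dist (y n) (ystar (x n))) \<longlonglongrightarrow> 0"
proof (rule ccontr)
  assume "\<not> ?thesis"
  then obtain \<epsilon> r0 where "\<epsilon> > 0" "strict_mono (r0::nat \<Rightarrow> nat)"
      "\<And>n. dist (dist (y (r0 n)) (ystar (x (r0 n)))) 0 \<ge> \<epsilon>"
    using not_tendsto_subseq by blast
  then have far0: "\<And>n. \<epsilon> \<le> dist (y (r0 n)) (ystar (x (r0 n)))" by simp
  have "seq_compact (C \<times> D)"
    using compact_CD by (simp add: compact_eq_seq_compact_metric)
  moreover have "\<forall>n. (x (r0 n), y (r0 n)) \<in> C \<times> D" using xC yD by simp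
  ultimately obtain l0 r1 where l0: "l0 \<in> C \<times> D" and r1: "strict_mono (r1::nat \<Rightarrow> nat)"
    and "((\<lambda>n. (x (r0 n), y (r0 n))) \<circ> r1) \<longlonglongrightarrow> l0"
    by (rule seq_compactE)
  define r where "r = r0 \<circ> r1"
  have r: "strict_mono r" unfolding r_def by (rule strict_mono_o) fact+
  have far: "\<epsilon> \<le> dist (y (r n)) (ystar (x (r n)))" for n using far0 by (simp add: r_def)
  have lim: "(\<lambda>n. (x (r n), y (r n))) \<longlonglongrightarrow> l0"
    using \<open>(_ \<circ> r1) \<longlonglongrightarrow> l0\<close> by (simp add: o_def r_def)
  define \<xi> where "\<xi> = fst l0"
  have "\<xi> \<in> C" using l0 by (auto simp: \<xi>_def)
  have limx: "(\<lambda>n. x (r n)) \<longlonglongrightarrow> \<xi>" and limy: "(\<lambda>n. y (r n)) \<longlonglongrightarrow> snd l0"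
    using tendsto_fst[OF lim] tendsto_snd[OF lim] by (simp_all add: \<xi>_def)
  have "(\<lambda>n. ystar (x (r n))) \<longlonglongrightarrow> ystar \<xi>"
    by (rule continuous_on_tendsto_compose[OF cont_ystar limx \<open>\<xi> \<in> C\<close>]) (simp add: xC)
  then have "\<epsilon> \<le> dist (snd l0) (ystar \<xi>)"
    by (intro LIMSEQ_le_const[OF tendsto_dist[OF limy]]) (use far in auto)
  have cont_fibre: "continuous_on D (\<lambda>v. G (\<xi>, v))"
    by (rule continuous_on_compose2[OF cont_G]) (auto intro!: continuous_intros \<open>\<xi> \<in> C\<close>)
  obtain T where T: "T \<ge> 0" "\<And>t v. t \<ge> T \<Longrightarrow> v \<in> D \<Longrightarrow> dist (ode_flow D (\<lambda>v. G (\<xi>, v)) t v) (ystar \<xi>) < \<epsilon>"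
    using globally_attracting_uniformly[OF compact_D cont_fibre fast_uniq[OF \<open>\<xi> \<in> C\<close>] fast_attr[OF \<open>\<xi> \<in> C\<close>] \<open>\<epsilon> > 0\<close>]
    by blast
  \<comment> \<open>The cut-off at \<open>0\<close> affects only finitely many \<open>n\<close>; it
    keeps \<open>clock\<close> away from negative times, where its defining set is empty.\<close>
  define b where "b n = max 0 (tau \<gamma> (r n) - T)" for n
  define m where "m n = clock \<gamma> (b n)" for n
  have taur: "filterlim (\<lambda>n. tau \<gamma> (r n)) at_top sequentially"
    by (rule filterlim_compose[OF fast.tau_at_top filterlim_subseq[OF r]])
  have "filterlim b at_top sequentially"
    unfolding b_def filterlim_at_top
  proof
    fix Z
    from taur have "\<forall>\<^sub>F n in sequentially. tau \<gamma> (r n) \<ge> Z + T" by (simp add: filterlim_at_top)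
    then show "\<forall>\<^sub>F n in sequentially. Z \<le> max 0 (tau \<gamma> (r n) - T)" by eventually_elim auto
  qed
  then have m: "filterlim m sequentially sequentially"
    unfolding m_def by (rule filterlim_compose[OF fast.clock_at_top])
  have "m n \<le> r n" for n
    using fast.clock_mono[of "b n" "tau \<gamma> (r n)"] T(1) unfolding m_def b_def by simp
  define \<sigma> where "\<sigma> n = tau \<gamma> (r n) - tau \<gamma> (m n)" for n
  have \<sigma>_nonneg: "\<sigma> n \<ge> 0" for n using fast.tau_mono[OF \<open>m n \<le> r n\<close>] by (simp add: \<sigma>_def)
  have "\<forall>\<^sub>F n in sequentially. tau \<gamma> (r n) \<ge> T"
    using taur by (simp add: filterlim_at_top)
  \<comment> \<open>Rounding the start down to a grid time lengthens the window \<open>T\<close> by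
    less than one step.\<close>
  then have "\<forall>\<^sub>F n in sequentially. norm (\<sigma> n - T) \<le> \<gamma> (Suc (m n))"
  proof eventually_elim
    case (elim n)
    have "b n \<ge> 0" by (simp add: b_def)
    from fast.clock_le[OF this] fast.clock_gt[OF this] elim show ?case
      unfolding m_def[symmetric] by (simp add: b_def \<sigma>_def)
  qed
  moreover have "(\<lambda>n. \<gamma> (Suc (m n))) \<longlonglongrightarrow> 0"
    using filterlim_compose[OF LIMSEQ_Suc[OF fast.tendsto_0] m] .
  ultimately have "(\<lambda>n. \<sigma> n - T) \<longlonglongrightarrow> 0" by (rule Lim_null_comparison)
  then have \<sigma>: "\<sigma> \<longlonglongrightarrow> T" by (rule LIM_zero_cancel)
  let ?\<Psi> = "ode_flow (C \<times> D) (\<lambda>p. (0, G p))"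
  have "(\<lambda>n. dist (x (r n), y (r n)) (?\<Psi> (\<sigma> n) (x (m n), y (m n)))) \<longlonglongrightarrow> 0"
  proof (rule tendstoI)
    fix \<delta> :: real assume "\<delta> > 0"
    \<comment> \<open>Because \<open>\<sigma> n\<close> may exceed \<open>T\<close>, the flow is
      tracked over the longer window \<open>T + 1\<close>.\<close>
    have "\<forall>\<^sub>F n in sequentially. \<sigma> n < T + 1" by (rule order_tendstoD(2)[OF \<sigma>]) simp
    with filterlim_iff[THEN iffD1, OF m, rule_format, OF fast.tracks_flow[OF \<open>\<delta> > 0\<close>, of "T + 1"]]
    show "\<forall>\<^sub>F n in sequentially.
        dist (dist (x (r n), y (r n)) (?\<Psi> (\<sigma> n) (x (m n), y (m n)))) 0 < \<delta>"
      by eventually_elim (use \<open>\<And>n. m n \<le> r n\<close> in \<open>simp add: \<sigma>_def\<close>)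
  qed
  moreover have "\<forall>n. (x (m n), y (m n)) \<in> C \<times> D" using xC yD by simp
  with \<open>seq_compact (C \<times> D)\<close>
  obtain l s where l: "l \<in> C \<times> D" and s: "strict_mono (s::nat \<Rightarrow> nat)"
    and "((\<lambda>n. (x (m n), y (m n))) \<circ> s) \<longlonglongrightarrow> l"
    by (rule seq_compactE)
  then have lim_s: "(\<lambda>n. (x (m (s n)), y (m (s n)))) \<longlonglongrightarrow> l" by (simp add: o_def)
  ultimately have "(\<lambda>n. dist (x (r (s n)), y (r (s n))) (?\<Psi> (\<sigma> (s n)) (x (m (s n)), y (m (s n))))) \<longlonglongrightarrow> 0"
    using LIMSEQ_subseq_LIMSEQ[OF _ s] by (simp add: o_def)
  moreover have "(\<lambda>n. ?\<Psi> (\<sigma> (s n)) (x (m (s n)), y (m (s n)))) \<longlonglongrightarrow> ?\<Psi> T l"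
    using LIMSEQ_subseq_LIMSEQ[OF \<sigma> s] xC yD
    by (intro ode_flow_tendsto[OF fast.compact fast.cont fast.uniq lim_s _ _ \<sigma>_nonneg]) (auto simp: o_def)
  from tendsto_dist[OF LIMSEQ_subseq_LIMSEQ[OF lim s, unfolded o_def] this]
  have "(\<lambda>n. dist (x (r (s n)), y (r (s n))) (?\<Psi> (\<sigma> (s n)) (x (m (s n)), y (m (s n)))))
      \<longlonglongrightarrow> dist l0 (?\<Psi> T l)" .
  \<comment> \<open>The same distances tend to 0 by tracking and to
    \<open>dist l0 (?\<Psi> T l)\<close> by continuity of the flow.\<close>
  ultimately have "dist l0 (?\<Psi> T l) = 0" by (rule LIMSEQ_unique[rotated])
  moreover have "fst l \<in> C" "snd l \<in> D" using l by auto
  from ode_flow_frozen[where G = G, OF fast_uniq this T(1)]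
  have "?\<Psi> T l = (fst l, ode_flow D (\<lambda>v. G (fst l, v)) T (snd l))" by simp
  ultimately have "fst l = \<xi>" "snd l0 = ode_flow D (\<lambda>v. G (\<xi>, v)) T (snd l)"
    by (simp_all add: \<xi>_def)
  then have "dist (snd l0) (ystar \<xi>) < \<epsilon>" using T(2)[of T "snd l"] l by auto
  then show False using \<open>\<epsilon> \<le> dist (snd l0) (ystar \<xi>)\<close> by simp
qed

lemma cont_reduced: "continuous_on C (\<lambda>u. F (u, ystar u))"
  by (rule continuous_on_compose2[OF cont_F]) (auto intro!: continuous_intros cont_ystar ystar_in)

text \<open>Uniform continuity of \<open>F\<close> on the compact product turns closeness of
  \<open>y n\<close> to \<open>ystar (x n)\<close> into closeness of the drifts, so the drift
  discrepancy is a null sequence.\<close>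

sublocale slow: perturbed_iteration \<alpha> C "\<lambda>u. F (u, ystar u)" x
  "\<lambda>n. (F (x n, y n) - F (x n, ystar (x n))) + e n"
proof
  have unif: "uniformly_continuous_on (C \<times> D) F" by (rule compact_uniformly_continuous[OF cont_F compact_CD])
  have "(\<lambda>n. dist (F (x n, y n)) (F (x n, ystar (x n)))) \<longlonglongrightarrow> 0"
  proof (rule tendstoI)
    fix \<epsilon> :: real assume "\<epsilon> > 0"
    then obtain \<delta> where \<delta>: "\<delta> > 0" "\<And>p q. p \<in> C \<times> D \<Longrightarrow> q \<in> C \<times> D \<Longrightarrow> dist p q < \<delta> \<Longrightarrow> dist (F p) (F q) < \<epsilon>"
      using unif unfolding uniformly_continuous_on_def by metis
    from order_tendstoD(2)[OF dist_y_ystar_tendsto_0 \<delta>(1)]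
    show "\<forall>\<^sub>F n in sequentially. dist (dist (F (x n, y n)) (F (x n, ystar (x n)))) 0 < \<epsilon>"
    proof eventually_elim
      case (elim n)
      have "dist (x n, y n) (x n, ystar (x n)) < \<delta>" using elim by (simp add: dist_Pair_Pair)
      then show ?case using \<delta>(2)[of "(x n, y n)" "(x n, ystar (x n))"] xC yD ystar_in by simp
    qed
  qed
  then have "(\<lambda>n. F (x n, y n) - F (x n, ystar (x n))) \<longlonglongrightarrow> 0"
    unfolding dist_norm by (rule tendsto_norm_zero_cancel)
  from negligible_noise_add[OF slow.negligible_noise_if_tendsto_0[OF this] slow_noise]
  show "negligible_noise \<alpha> (\<lambda>n. (F (x n, y n) - F (x n, ystar (x n))) + e n)" .
  show "x (Suc n) = x n + \<alpha> (Suc n) *\<^sub>R (F (x n, ystar (x n)) + ((F (x n, y n) - F (x n, ystar (x n))) + e n))" for n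
    by (simp add: x_step)
qed (fact compact_C cont_reduced slow_uniq xC)+

end

section \<open>Interpolation\<close>

lemma tendsto_SUP_0:
  fixes h :: "'a \<Rightarrow> 'b \<Rightarrow> real"
  assumes "A \<noteq> {}" "\<And>t s. h t s \<ge> 0"
    and small: "\<And>\<epsilon>. \<epsilon> > 0 \<Longrightarrow> \<forall>\<^sub>F t in net. \<forall>s\<in>A. h t s < \<epsilon>"
  shows "((\<lambda>t. SUP s\<in>A. h t s) \<longlongrightarrow> 0) net"
proof (rule tendstoI)
  fix \<epsilon> :: real assume "\<epsilon> > 0"
  \<comment> \<open>A supremum of values below a bound is only at most that bound; halving restores
    the strict inequality.\<close>
  then have "\<epsilon> / 2 > 0" by simp
  from small[OF this] show "\<forall>\<^sub>F t in net. dist (SUP s\<in>A. h t s) 0 < \<epsilon>"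
  proof eventually_elim
    case (elim t)
    obtain s where "s \<in> A" using assms(1) by blast
    have "bdd_above (h t ` A)" by (rule bdd_aboveI2[of _ _ "\<epsilon> / 2"]) (use elim in force)
    then have "0 \<le> (SUP s\<in>A. h t s)" by (rule cSUP_upper2[OF _ \<open>s \<in> A\<close> assms(2)])
    moreover have "(SUP s\<in>A. h t s) \<le> \<epsilon> / 2"
      by (rule cSUP_least[OF assms(1)]) (use elim in force)
    ultimately show ?case using \<open>\<epsilon> > 0\<close> by simp
  qed
qed

lemma dist_Pair_le: "dist (a, b) (c, d) \<le> dist a c + dist b d"
  by (simp add: dist_Pair_Pair sqrt_sum_squares_le_sum)

context step_sizes
begin

text \<open>The formula extends to the right end point, whose value comes from the next step at
  \<open>s = 0\<close>. This agreement allows the closed pieces to be glued.\<close>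

lemma interpolation_at_step:
  fixes u :: "nat \<Rightarrow> 'b::real_vector"
  assumes "\<And>n s. 0 \<le> s \<Longrightarrow> s < a (Suc n) \<Longrightarrow>
      z (tau a n + s) = u n + s *\<^sub>R ((u (Suc n) - u n) /\<^sub>R a (Suc n))"
    and "tau a n \<le> t" "t \<le> tau a (Suc n)"
  shows "z t = u n + ((t - tau a n) / a (Suc n)) *\<^sub>R (u (Suc n) - u n)"
proof (cases "t = tau a (Suc n)")
  case True
  have "a (Suc n) \<noteq> 0" by (rule less_imp_neq[OF Suc_pos, symmetric])
  then show ?thesis using assms(1)[of 0 "Suc n"] by (simp add: True)
next
  case False
  then show ?thesis using assms(1)[of "t - tau a n" n] assms(2,3) by (simp add: divide_inverse)
qed

lemma continuous_on_interpolation: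
  fixes u :: "nat \<Rightarrow> 'b::real_normed_vector"
  assumes z: "\<And>n s. 0 \<le> s \<Longrightarrow> s < a (Suc n) \<Longrightarrow>
      z (tau a n + s) = u n + s *\<^sub>R ((u (Suc n) - u n) /\<^sub>R a (Suc n))"
  shows "continuous_on {0..} z"
proof -
  have piece: "continuous_on {tau a n..tau a (Suc n)} z" for n
  proof (rule continuous_on_eq)
    show "continuous_on {tau a n..tau a (Suc n)}
        (\<lambda>t. u n + ((t - tau a n) / a (Suc n)) *\<^sub>R (u (Suc n) - u n))"
      by (intro continuous_intros ballI) (rule less_imp_neq[OF Suc_pos, symmetric])
  qed (rule interpolation_at_step[OF z, symmetric]; simp)
  have initial: "continuous_on {0..tau a n} z" for n
  proof (induction n)
    case (Suc n)
    have "{0..tau a (Suc n)} = {0..tau a n} \<union> {tau a n..tau a (Suc n)}"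
      using tau_nonneg[of n] tau_mono[of n "Suc n"] by (intro ivl_disj_un_two_touch(4)[symmetric]) auto
    then show ?case using continuous_on_closed_Un[OF _ _ Suc.IH piece] by simp
  qed simp
  show ?thesis
    unfolding continuous_on_eq_continuous_within
  proof
    fix t :: real assume t: "t \<in> {0..}"
    \<comment> \<open>Continuity is local: \<open>t\<close> lies strictly before
      \<open>tau a ?n\<close>, so finitely many glued pieces already form a neighbourhood of
      \<open>t\<close> in the half-line.\<close>
    let ?n = "Suc (clock a t)"
    have "t < tau a ?n" using clock_gt[of t] t by simp
    have "at t within {0..} = at t within {0..tau a ?n}"
      by (rule at_within_nhd[of t "{..<tau a ?n}"]) (use \<open>t < tau a ?n\<close> in auto)
    moreover have "continuous (at t within {0..tau a ?n}) z"
      using initial[of ?n] t \<open>t < tau a ?n\<close> by (auto simp: continuous_on_eq_continuous_within)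
    ultimately show "continuous (at t within {0..}) z" by simp
  qed
qed

lemma dist_interpolation_le:
  fixes u :: "nat \<Rightarrow> 'b::real_normed_vector"
  assumes z: "\<And>n s. 0 \<le> s \<Longrightarrow> s < a (Suc n) \<Longrightarrow>
      z (tau a n + s) = u n + s *\<^sub>R ((u (Suc n) - u n) /\<^sub>R a (Suc n))"
    and "t \<ge> 0"
  shows "dist (z t) (u (clock a t)) \<le> dist (u (Suc (clock a t))) (u (clock a t))"
proof -
  let ?n = "clock a t" and ?\<theta> = "(t - tau a (clock a t)) / a (Suc (clock a t))"
  note bounds = clock_le[OF \<open>t \<ge> 0\<close>] clock_gt[OF \<open>t \<ge> 0\<close>]
  have "z t = u ?n + ?\<theta> *\<^sub>R (u (Suc ?n) - u ?n)"
    by (rule interpolation_at_step[OF z]) (use bounds in auto)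
  moreover have "\<bar>?\<theta>\<bar> \<le> 1" using bounds Suc_pos[of ?n] by (simp del: Suc_pos)
  ultimately show ?thesis by (simp add: dist_norm mult_left_le_one_le del: abs_divide)
qed

end

context perturbed_iteration
begin

text \<open>Consecutive iterates are values of the \<open>n\<close>-th shifted step function at
  times \<open>0\<close> and \<open>a (Suc n)\<close>. This time gap tends to 0, so asymptotic
  equicontinuity applies.\<close>

lemma dist_Suc_tendsto_0: "(\<lambda>n. dist (u (Suc n)) (u n)) \<longlonglongrightarrow> 0"
proof (rule tendstoI)
  fix \<epsilon> :: real assume "\<epsilon> > 0"
  then have "\<epsilon> / 2 > 0" by simp
  obtain \<eta> where \<eta>: "\<eta> > 0" "\<forall>\<^sub>F n in sequentially. \<forall>s\<ge>0. \<forall>t\<ge>0. \<bar>t - s\<bar> \<le> \<eta> \<longrightarrow>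
      dist (u (clock a (tau a n + t))) (u (clock a (tau a n + s))) \<le> \<epsilon> / 2"
    by (rule approximate_solutions_equicontinuous[OF approximate_solutions_shifts compact cont \<open>\<epsilon> / 2 > 0\<close>])
  have "\<forall>\<^sub>F n in sequentially. a (Suc n) < \<eta>"
    using order_tendstoD(2)[OF LIMSEQ_Suc[OF tendsto_0] \<eta>(1)] .
  with \<eta>(2) show "\<forall>\<^sub>F n in sequentially. dist (dist (u (Suc n)) (u n)) 0 < \<epsilon>"
  proof eventually_elim
    case (elim n)
    have "\<bar>a (Suc n) - 0\<bar> \<le> \<eta>" "a (Suc n) \<ge> 0" using elim(2) Suc_pos[of n] by linarith+
    then have "dist (u (clock a (tau a n + a (Suc n)))) (u (clock a (tau a n + 0))) \<le> \<epsilon> / 2"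
      using elim(1) by blast
    then show ?case using \<open>\<epsilon> > 0\<close> clock_tau[of "Suc n"] by simp
  qed
qed

text \<open>Serves both notions of the conclusion: \<open>p = z\<close> with a semiflow extending
  the flow, and arbitrary \<open>p\<close> in \<open>S\<close> with the flow itself. Passing through
  the iterates \<open>u n\<close> and \<open>u k\<close> reduces it to
  \<open>tracks_flow\<close>.\<close>

lemma interpolation_tracks_semiflow:
  assumes z: "\<And>n s. 0 \<le> s \<Longrightarrow> s < a (Suc n) \<Longrightarrow>
      z (tau a n + s) = u n + s *\<^sub>R ((u (Suc n) - u n) /\<^sub>R a (Suc n))"
    and "S \<subseteq> M" and \<Psi>: "semiflow_on M \<Psi>" "\<And>t v. t \<ge> 0 \<Longrightarrow> v \<in> S \<Longrightarrow> \<Psi> t v = ode_flow S f t v"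
    and p: "\<And>t. t \<ge> 0 \<Longrightarrow> p t \<in> M" "((\<lambda>t. dist (p t) (z t)) \<longlongrightarrow> 0) at_top" and "T > 0"
  shows "((\<lambda>t. SUP s\<in>{0..T}. dist (z (t + s)) (\<Psi> s (p t))) \<longlongrightarrow> 0) at_top"
proof (rule tendsto_SUP_0)
  fix \<epsilon> :: real assume "\<epsilon> > 0"
  then have "\<epsilon> / 2 > 0" "\<epsilon> / 4 > 0" by simp_all
  \<comment> \<open>Only the grid times and iterates range over a compact set; the point
    \<open>p t\<close> may lie anywhere in \<open>M\<close>. The bound \<open>T + 1\<close> allows
    for the rounding of times.\<close>
  have "continuous_on ({0..} \<times> M) (\<lambda>(t, x). \<Psi> t x)" using \<Psi>(1) unfolding semiflow_on_def by blast
  moreover have "compact ({0..T + 1} \<times> S)" by (intro compact_Times compact compact_Icc)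
  moreover have "{0..T + 1} \<times> S \<subseteq> {0..} \<times> M" using \<open>S \<subseteq> M\<close> by auto
  ultimately obtain \<delta> where \<delta>: "\<delta> > 0" "\<And>q q'. q \<in> {0..T + 1} \<times> S \<Longrightarrow> q' \<in> {0..} \<times> M \<Longrightarrow> dist q' q < \<delta> \<Longrightarrow>
      dist (case_prod \<Psi> q') (case_prod \<Psi> q) < \<epsilon> / 2"
    using continuous_on_uniform_near_compact[OF _ _ _ \<open>\<epsilon> / 2 > 0\<close>] by blast
  \<comment> \<open>The budget \<open>\<delta>\<close> is split in three: \<open>\<rho>\<close> for
    the time difference, \<open>\<rho>\<close> from \<open>p t\<close> to \<open>z t\<close>, and
    \<open>\<rho>\<close> from \<open>z t\<close> to \<open>u n\<close>.\<close>
  define \<rho> where "\<rho> = min 1 (\<delta> / 3)"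
  have \<rho>: "\<rho> > 0" "\<rho> \<le> 1" "\<rho> \<le> \<delta> / 3" using \<delta>(1) by (auto simp: \<rho>_def)
  obtain N1 where N1: "\<And>n. n \<ge> N1 \<Longrightarrow> a n < \<rho>"
    using order_tendstoD(2)[OF tendsto_0 \<rho>(1)] unfolding eventually_sequentially by blast
  \<comment> \<open>Small increments are needed twice: at \<open>k\<close> for the end point, within
    \<open>\<epsilon> / 4\<close>, and at \<open>n\<close> for the starting point, within
    \<open>\<rho>\<close>.\<close>
  have "min (\<epsilon> / 4) \<rho> > 0" using \<open>\<epsilon> > 0\<close> \<rho>(1) by simp
  from order_tendstoD(2)[OF dist_Suc_tendsto_0 this]
  obtain N2 where N2: "\<And>n. n \<ge> N2 \<Longrightarrow> dist (u (Suc n)) (u n) < min (\<epsilon> / 4) \<rho>"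
    unfolding eventually_sequentially by blast
  obtain N3 where N3: "\<And>n k. n \<ge> N3 \<Longrightarrow> k \<ge> n \<Longrightarrow> tau a k - tau a n \<le> T + 1 \<Longrightarrow>
      dist (u k) (ode_flow S f (tau a k - tau a n) (u n)) < \<epsilon> / 4"
    using tracks_flow[OF \<open>\<epsilon> / 4 > 0\<close>, of "T + 1"] unfolding eventually_sequentially by blast
  have "\<forall>\<^sub>F t in at_top. max N1 (max N2 N3) \<le> clock a t"
    using clock_at_top unfolding filterlim_at_top by blast
  moreover have "\<forall>\<^sub>F t in at_top. dist (p t) (z t) < \<rho>"
    by (rule order_tendstoD(2)[OF p(2) \<rho>(1)])
  moreover have "\<forall>\<^sub>F t in at_top. t \<ge> (0::real)" by (rule eventually_ge_at_top)
  ultimately show "\<forall>\<^sub>F t in at_top. \<forall>s\<in>{0..T}. dist (z (t + s)) (\<Psi> s (p t)) < \<epsilon>"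
  proof eventually_elim
    case (elim t)
    show ?case
    proof
      fix s assume s: "s \<in> {0..T}"
      define n where "n = clock a t"
      define k where "k = clock a (t + s)"
      have "t + s \<ge> 0" using elim(3) s by simp
      have n: "n \<ge> N1" "n \<ge> N2" "n \<ge> N3" using elim(1) by (auto simp: n_def)
      have "n \<le> k" unfolding n_def k_def using elim(3) s by (intro clock_mono) auto
      have "a (Suc n) < \<rho>" "a (Suc k) < \<rho>" using N1 n(1) \<open>n \<le> k\<close> by auto
      then have time: "\<bar>(tau a k - tau a n) - s\<bar> < \<rho>"
        using clock_le[OF elim(3)] clock_gt[OF elim(3)] clock_le[OF \<open>t + s \<ge> 0\<close>] clock_gt[OF \<open>t + s \<ge> 0\<close>]
        unfolding n_def[symmetric] k_def[symmetric] by linarith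
      then have "tau a k - tau a n \<le> T + 1" using s \<rho>(2) by auto
      have "tau a k - tau a n \<ge> 0" using tau_mono[OF \<open>n \<le> k\<close>] by simp
      have 1: "dist (z (t + s)) (u k) < \<epsilon> / 4"
        using dist_interpolation_le[OF z \<open>t + s \<ge> 0\<close>] N2[of k] n(2) \<open>n \<le> k\<close>
        unfolding k_def[symmetric] by simp
      have 2: "dist (u k) (\<Psi> (tau a k - tau a n) (u n)) < \<epsilon> / 4"
        unfolding \<Psi>(2)[OF \<open>tau a k - tau a n \<ge> 0\<close> inS]
        by (rule N3[OF n(3) \<open>n \<le> k\<close> \<open>tau a k - tau a n \<le> T + 1\<close>])
      have "dist (z t) (u n) < \<rho>"
        using dist_interpolation_le[OF z elim(3)] N2[OF n(2)] unfolding n_def[symmetric] by simp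
      then have "dist (p t) (u n) < 2 * \<rho>"
        using elim(2) dist_triangle[of "p t" "u n" "z t"] by linarith
      moreover have "dist s (tau a k - tau a n) < \<rho>" using time by (simp add: dist_real_def)
      ultimately have "dist (s, p t) (tau a k - tau a n, u n) < \<delta>"
        using dist_Pair_le[of s "p t" "tau a k - tau a n" "u n"] \<rho>(3) by linarith
      then have "dist (\<Psi> s (p t)) (\<Psi> (tau a k - tau a n) (u n)) < \<epsilon> / 2"
        using \<delta>(2)[of "(tau a k - tau a n, u n)" "(s, p t)"] inS p(1)[OF elim(3)] s
          \<open>tau a k - tau a n \<ge> 0\<close> \<open>tau a k - tau a n \<le> T + 1\<close> by simp
      moreover have "dist (z (t + s)) (\<Psi> s (p t)) \<le> dist (z (t + s)) (u k)
          + dist (u k) (\<Psi> (tau a k - tau a n) (u n)) + dist (\<Psi> s (p t)) (\<Psi> (tau a k - tau a n) (u n))"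
        using dist_triangle[of "z (t + s)" "\<Psi> s (p t)" "u k"]
          dist_triangle[of "u k" "\<Psi> s (p t)" "\<Psi> (tau a k - tau a n) (u n)"]
        by (simp add: dist_commute)
      ultimately show "dist (z (t + s)) (\<Psi> s (p t)) < \<epsilon>" using 1 2 by linarith
    qed
  qed
qed (use \<open>T > 0\<close> in auto)

lemma interpolation_asymptotic_pseudotrajectory:
  assumes z: "\<And>n s. 0 \<le> s \<Longrightarrow> s < a (Suc n) \<Longrightarrow>
      z (tau a n + s) = u n + s *\<^sub>R ((u (Suc n) - u n) /\<^sub>R a (Suc n))"
  shows "asymptotic_pseudotrajectory_to_flow S (ode_flow S f) z"
    and "asymptotically_shadows S (ode_flow S f) z"
proof -
  note z_cont = continuous_on_interpolation[OF z]
  show "asymptotic_pseudotrajectory_to_flow S (ode_flow S f) z"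
    unfolding asymptotic_pseudotrajectory_to_flow_def asymptotic_pseudotrajectory_def
  proof (intro allI impI conjI z_cont; elim conjE)
    fix M \<Psi> and T :: real
    assume "S \<subseteq> M" "\<forall>t\<ge>0. z t \<in> M" "semiflow_on M \<Psi>" "\<forall>t\<ge>0. \<forall>x\<in>S. \<Psi> t x = ode_flow S f t x" "T > 0"
    then show "((\<lambda>t. SUP s\<in>{0..T}. dist (z (t + s)) (\<Psi> s (z t))) \<longlongrightarrow> 0) at_top"
      by (intro interpolation_tracks_semiflow[OF z]) auto
  qed blast+
  \<comment> \<open>The iterate last reached by time \<open>t\<close> witnesses that suitable
    starting points in \<open>S\<close> exist.\<close>
  have "((\<lambda>t. dist (u (clock a t)) (z t)) \<longlongrightarrow> 0) at_top"
  proof (rule Lim_null_comparison)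
    show "\<forall>\<^sub>F t in at_top. norm (dist (u (clock a t)) (z t)) \<le> dist (u (Suc (clock a t))) (u (clock a t))"
      using eventually_ge_at_top[of 0]
      by eventually_elim (use dist_interpolation_le[OF z] in \<open>simp add: dist_commute\<close>)
    show "((\<lambda>t. dist (u (Suc (clock a t))) (u (clock a t))) \<longlongrightarrow> 0) at_top"
      by (rule filterlim_compose[OF dist_Suc_tendsto_0 clock_at_top])
  qed
  moreover have "((\<lambda>t. SUP s\<in>{0..T}. dist (z (t + s)) (ode_flow S f s (p t))) \<longlongrightarrow> 0) at_top"
    if "\<forall>t\<ge>0. p t \<in> S" "((\<lambda>t. dist (p t) (z t)) \<longlongrightarrow> 0) at_top" "T > 0" for p T
    using that
    by (intro interpolation_tracks_semiflow[OF z order_refl semiflow_on_ode_flow[OF compact cont uniq]]) auto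
  moreover have "\<forall>t\<ge>0. u (clock a t) \<in> S" using inS by blast
  ultimately show "asymptotically_shadows S (ode_flow S f) z"
    unfolding asymptotically_shadows_def
    by (intro conjI z_cont allI impI exI[of _ "\<lambda>t. u (clock a t)"]) auto
qed

end

section \<open>Reduction of the almost sure statement to a single sample path\<close>

theorem theorem3:
  fixes P :: "'w measure"
    and F :: "'a::banach \<times> 'b::banach \<Rightarrow> 'a" and G :: "'a \<times> 'b \<Rightarrow> 'b"
    and x U c :: "nat \<Rightarrow> 'w \<Rightarrow> 'a" and y V d :: "nat \<Rightarrow> 'w \<Rightarrow> 'b"
    and \<alpha> \<gamma> :: "nat \<Rightarrow> real"
    and C :: "'a set" and D :: "'b set" and ystar :: "'a \<Rightarrow> 'b"
    and xbar :: "'w \<Rightarrow> real \<Rightarrow> 'a"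
  assumes P: "prob_space P"
    and processes: "\<And>n. U n \<in> borel_measurable P" "\<And>n. V n \<in> borel_measurable P"
    and rates_pos: "\<And>n. n \<ge> 1 \<Longrightarrow> \<alpha> n > 0" "\<And>n. n \<ge> 1 \<Longrightarrow> \<gamma> n > 0"
    and x_step: "AE \<omega> in P. \<forall>n. x (n + 1) \<omega> =
          x n \<omega> + \<alpha> (n + 1) *\<^sub>R (F (x n \<omega>, y n \<omega>) + U (n + 1) \<omega> + c (n + 1) \<omega>)"
    and y_step: "AE \<omega> in P. \<forall>n. y (n + 1) \<omega> =
          y n \<omega> + \<gamma> (n + 1) *\<^sub>R (G (x n \<omega>, y n \<omega>) + V (n + 1) \<omega> + d (n + 1) \<omega>)"
    and A1a: "AE \<omega> in P. noise_vanishes \<alpha> (\<lambda>n. U n \<omega>)"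
             "AE \<omega> in P. noise_vanishes \<gamma> (\<lambda>n. V n \<omega>)"
    and A1b: "AE \<omega> in P. Bseq (\<lambda>n. c n \<omega>) \<and> (\<lambda>n. norm (c n \<omega>)) \<longlonglongrightarrow> 0"
             "AE \<omega> in P. Bseq (\<lambda>n. d n \<omega>) \<and> (\<lambda>n. norm (d n \<omega>)) \<longlonglongrightarrow> 0"
    and A2a: "compact C" "compact D"
             "AE \<omega> in P. \<forall>n. x n \<omega> \<in> C \<and> y n \<omega> \<in> D"
    and A2b: "bounded (F ` (C \<times> D))" "uniformly_continuous_on (C \<times> D) F"
             "bounded (G ` (C \<times> D))" "uniformly_continuous_on (C \<times> D) G"
    and A3a: "filterlim (tau \<alpha>) at_top sequentially" "filterlim (tau \<gamma>) at_top sequentially"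
             "\<alpha> \<longlonglongrightarrow> 0" "\<gamma> \<longlonglongrightarrow> 0"
    and A3b: "(\<lambda>n. \<alpha> n / \<gamma> n) \<longlonglongrightarrow> 0"
    and A4a: "\<And>\<xi>. \<xi> \<in> C \<Longrightarrow> unique_solutions_in D (\<lambda>v. G (\<xi>, v))"
             "\<And>\<xi>. \<xi> \<in> C \<Longrightarrow>
                globally_attracting_fixed_point D (\<lambda>v. G (\<xi>, v)) (ystar \<xi>) \<and>
                (\<forall>p. globally_attracting_fixed_point D (\<lambda>v. G (\<xi>, v)) p \<longrightarrow> p = ystar \<xi>)"
             "\<exists>L. L-lipschitz_on C ystar"
    and A4b: "unique_solutions_in C (\<lambda>u. F (u, ystar u))"
    and interpolation: "\<And>\<omega> n s. 0 \<le> s \<Longrightarrow> s < \<alpha> (n + 1) \<Longrightarrow>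
          xbar \<omega> (tau \<alpha> n + s) = x n \<omega> + s *\<^sub>R ((x (n + 1) \<omega> - x n \<omega>) /\<^sub>R \<alpha> (n + 1))"
  shows "semiflow_on C (ode_flow C (\<lambda>u. F (u, ystar u))) \<and>
    (AE \<omega> in P.
       asymptotic_pseudotrajectory_to_flow C (ode_flow C (\<lambda>u. F (u, ystar u))) (xbar \<omega>) \<and>
       asymptotically_shadows C (ode_flow C (\<lambda>u. F (u, ystar u))) (xbar \<omega>))"
proof -
  have F: "continuous_on (C \<times> D) F" and G: "continuous_on (C \<times> D) G"
    using A2b(2,4) by (simp_all add: uniformly_continuous_imp_continuous)
  have ystar: "continuous_on C ystar" using A4a(3) lipschitz_on_continuous_on by blast
  have ystar_in: "\<And>\<xi>. \<xi> \<in> C \<Longrightarrow> ystar \<xi> \<in> D"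
    using A4a(2) unfolding globally_attracting_fixed_point_def by blast
  have "continuous_on C (\<lambda>u. F (u, ystar u))"
    by (rule continuous_on_compose2[OF F]) (auto intro!: continuous_intros ystar ystar_in)
  then have "semiflow_on C (ode_flow C (\<lambda>u. F (u, ystar u)))"
    by (rule semiflow_on_ode_flow[OF A2a(1) _ A4b])
  moreover have "AE \<omega> in P.
       asymptotic_pseudotrajectory_to_flow C (ode_flow C (\<lambda>u. F (u, ystar u))) (xbar \<omega>) \<and>
       asymptotically_shadows C (ode_flow C (\<lambda>u. F (u, ystar u))) (xbar \<omega>)"
    \<comment> \<open>These almost sure conditions are finitely many, so they hold together outside
      one null set; for each remaining \<open>\<omega>\<close> the argument is
      deterministic.\<close>
    using x_step y_step A1a A1b A2a(3)
  proof eventually_elim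
    case (elim \<omega>)
    interpret slow: step_sizes \<alpha> by unfold_locales (fact rates_pos(1) A3a)+
    interpret fast: step_sizes \<gamma> by unfold_locales (fact rates_pos(2) A3a)+
    have c: "(\<lambda>n. c (Suc n) \<omega>) \<longlonglongrightarrow> 0" and d: "(\<lambda>n. d (Suc n) \<omega>) \<longlonglongrightarrow> 0"
      using elim(5,6) by (auto intro: LIMSEQ_Suc tendsto_norm_zero_cancel)
    interpret two_timescale \<alpha> \<gamma> F G C D ystar "\<lambda>n. x n \<omega>" "\<lambda>n. U (Suc n) \<omega> + c (Suc n) \<omega>"
        "\<lambda>n. y n \<omega>" "\<lambda>n. V (Suc n) \<omega> + d (Suc n) \<omega>"
    proof
      show "negligible_noise \<alpha> (\<lambda>n. U (Suc n) \<omega> + c (Suc n) \<omega>)"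
        by (intro negligible_noise_add slow.negligible_noise_if_noise_vanishes[OF elim(3)]
            slow.negligible_noise_if_tendsto_0[OF c])
      show "negligible_noise \<gamma> (\<lambda>n. V (Suc n) \<omega> + d (Suc n) \<omega>)"
        by (intro negligible_noise_add fast.negligible_noise_if_noise_vanishes[OF elim(4)]
            fast.negligible_noise_if_tendsto_0[OF d])
      show "x (Suc n) \<omega> = x n \<omega> + \<alpha> (Suc n) *\<^sub>R (F (x n \<omega>, y n \<omega>) + (U (Suc n) \<omega> + c (Suc n) \<omega>))" for n
        using elim(1) by (simp add: add.assoc)
      show "y (Suc n) \<omega> = y n \<omega> + \<gamma> (Suc n) *\<^sub>R (G (x n \<omega>, y n \<omega>) + (V (Suc n) \<omega> + d (Suc n) \<omega>))" for n
        using elim(2) by (simp add: add.assoc)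
      show "x n \<omega> \<in> C" "y n \<omega> \<in> D" for n using elim(7) by auto
      show "globally_attracting_fixed_point D (\<lambda>v. G (\<xi>, v)) (ystar \<xi>)" if "\<xi> \<in> C" for \<xi>
        using A4a(2)[OF that] by blast
    qed (fact A3b A2a F G A4a(1) ystar A4b)+
    have "xbar \<omega> (tau \<alpha> n + s) = x n \<omega> + s *\<^sub>R ((x (Suc n) \<omega> - x n \<omega>) /\<^sub>R \<alpha> (Suc n))"
      if "0 \<le> s" "s < \<alpha> (Suc n)" for n s
      using interpolation[of s n \<omega>] that by simp
    from slow.interpolation_asymptotic_pseudotrajectory[of "xbar \<omega>", OF this] show ?case by blast
  qed
  ultimately show ?thesis by blast
qed

end
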